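(* Let $(W_n)_n$ be a sequence of graphons $W_n:\Omega^2\to[0,1]$ converging to a graphon $W:\Omega^2\to[0,1]$ in the cut-distance, and let $F$ be an arbitrary finite graph. Then $\liminf_n\mathsf{til}(F,W_n)\ge\mathsf{til}(F,W)$.
   Context: $(\Omega,\nu)$ is an atomless Borel probability space; a graphon is a symmetric measurable $W:\Omega^2\to[0,1]$. The cut-norm is $\|V\|_\square=\sup_{A,B}|\int_{A\times B}V|$, and the cut-distance is $\delta_\square(U,W)=\inf_\varphi\|U-W^\varphi\|_\square$ over invertible measure-preserving $\varphi:\Omega\to\Omega$, $W^\varphi(x,y)=W(\varphi(x),\varphi(y))$. Let $F$ have vertex set $[k]$; $W^{\otimes F}(x_1,\dots,x_k)=\prod_{ij\in E(F),i<j}W(x_i,x_j)$, $\mathcal{F}_F(W)=\{W^{\otimes F}\neq0\}$. An $F$-tiling in $W$ is a measurable $\mathfrak{t}:\Omega^k\to[0,\infty)$ with $\{\mathfrak{t}\neq0\}\subset\mathcal{F}_F(W)$ such that for each $x\in\Omega$, $\sum_{\ell=1}^k\int\mathfrak{t}(x_1,\dots,x_{\ell-1},x,x_{\ell+1},\dots,x_k)\,\mathrm{d}\nu^{k-1}\le1$ (integrating over all coordinates except the $\ell$-th); its size is $\int\mathfrak{t}\,\mathrm{d}\nu^k$, and $\mathsf{til}(F,W)$ is the supremum of sizes of $F$-tilings in $W$. *)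

theory Defs
  imports "HOL-Probability.Probability"
begin

definition atomless :: "'a measure \<Rightarrow> bool" where
  "atomless M \<longleftrightarrow> (\<forall>A\<in>sets M. emeasure M A > 0 \<longrightarrow>
     (\<exists>B\<in>sets M. B \<subseteq> A \<and> 0 < emeasure M B \<and> emeasure M B < emeasure M A))"

definition graphon :: "'a measure \<Rightarrow> ('a \<Rightarrow> 'a \<Rightarrow> real) \<Rightarrow> bool" where
  "graphon M W \<longleftrightarrow> (\<lambda>(x, y). W x y) \<in> borel_measurable (M \<Otimes>\<^sub>M M)
     \<and> (\<forall>x\<in>space M. \<forall>y\<in>space M. W x y = W y x \<and> 0 \<le> W x y \<and> W x y \<le> 1)"

definition cut_norm :: "'a measure \<Rightarrow> ('a \<Rightarrow> 'a \<Rightarrow> real) \<Rightarrow> real" where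
  "cut_norm M V = (SUP AB \<in> sets M \<times> sets M.
      \<bar>LINT p : (fst AB \<times> snd AB) | (M \<Otimes>\<^sub>M M). V (fst p) (snd p)\<bar>)"

definition inv_mp :: "'a measure \<Rightarrow> ('a \<Rightarrow> 'a) \<Rightarrow> bool" where
  "inv_mp M \<phi> \<longleftrightarrow> bij_betw \<phi> (space M) (space M)
     \<and> \<phi> \<in> M \<rightarrow>\<^sub>M M \<and> the_inv_into (space M) \<phi> \<in> M \<rightarrow>\<^sub>M M
     \<and> distr M M \<phi> = M"

definition cut_dist :: "'a measure \<Rightarrow> ('a \<Rightarrow> 'a \<Rightarrow> real) \<Rightarrow> ('a \<Rightarrow> 'a \<Rightarrow> real) \<Rightarrow> real" where
  "cut_dist M U W = (INF \<phi> \<in> {\<phi>. inv_mp M \<phi>}. cut_norm M (\<lambda>x y. U x y - W (\<phi> x) (\<phi> y)))"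

text \<open>A finite graph F on vertex set {0..<k} (standing for [k]) is given by its edge set
E of pairs (i,j) with i < j < k.\<close>
definition fin_graph :: "nat \<Rightarrow> (nat \<times> nat) set \<Rightarrow> bool" where
  "fin_graph k E \<longleftrightarrow> E \<subseteq> {(i, j). i < j \<and> j < k}"

definition tensor_F :: "(nat \<times> nat) set \<Rightarrow> ('a \<Rightarrow> 'a \<Rightarrow> real) \<Rightarrow> (nat \<Rightarrow> 'a) \<Rightarrow> real" where
  "tensor_F E W x = (\<Prod>(i, j)\<in>E. W (x i) (x j))"

definition F_tiling :: "'a measure \<Rightarrow> nat \<Rightarrow> (nat \<times> nat) set \<Rightarrow> ('a \<Rightarrow> 'a \<Rightarrow> real)
    \<Rightarrow> ((nat \<Rightarrow> 'a) \<Rightarrow> real) \<Rightarrow> bool" where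
  "F_tiling M k E W t \<longleftrightarrow>
     t \<in> borel_measurable (PiM {0..<k} (\<lambda>_. M))
     \<and> (\<forall>x\<in>space (PiM {0..<k} (\<lambda>_. M)). 0 \<le> t x)
     \<and> (\<forall>x\<in>space (PiM {0..<k} (\<lambda>_. M)). t x \<noteq> 0 \<longrightarrow> tensor_F E W x \<noteq> 0)
     \<and> (\<forall>x\<in>space M. (\<Sum>l<k. \<integral>\<^sup>+ y. ennreal (t (y(l := x)))
                         \<partial>(PiM ({0..<k} - {l}) (\<lambda>_. M))) \<le> 1)"

definition tiling_size :: "'a measure \<Rightarrow> nat \<Rightarrow> ((nat \<Rightarrow> 'a) \<Rightarrow> real) \<Rightarrow> ennreal" where
  "tiling_size M k t = (\<integral>\<^sup>+ x. ennreal (t x) \<partial>(PiM {0..<k} (\<lambda>_. M)))"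

definition til :: "'a measure \<Rightarrow> nat \<Rightarrow> (nat \<times> nat) set \<Rightarrow> ('a \<Rightarrow> 'a \<Rightarrow> real) \<Rightarrow> ennreal" where
  "til M k E W = (SUP t \<in> {t. F_tiling M k E W t}. tiling_size M k t)"

end

theory Submission
  imports Defs
begin

text \<open>After rearranging each \<open>W\<^sub>n\<close> (which does not change its tiling number) we may assume that
  \<open>W\<^sub>n\<close> tends to \<open>W\<close> in cut norm. By truncation it suffices to treat tilings of \<open>W\<close> of the form
  \<open>g W\<^sup>F\<close> with \<open>g\<close> bounded, where \<open>W\<^sup>F\<close> denotes the tensor power. The counting lemma with vertex
  weights, uniform in the weights, together with an approximation of \<open>g\<close> by step functions shows that
  the total marginals \<open>m\<^sub>n\<close> of \<open>g W\<^sub>n\<^sup>F\<close> converge in \<open>L\<^sup>1\<close> to the total marginal \<open>m \<le> 1\<close> of \<open>g W\<^sup>F\<close>.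
  Dividing \<open>g W\<^sub>n\<^sup>F\<close> at each coordinate by \<open>max 1 m\<^sub>n\<close> therefore gives tilings of \<open>W\<^sub>n\<close>, and it costs at
  most the integral of \<open>m\<^sub>n - m\<close> over \<open>{m\<^sub>n > 1}\<close>.\<close>

section \<open>Weak convergence from a generator\<close>

text \<open>Since \<bar>T n\<bar> \<le> 1, replacing \<open>f\<close> by \<open>s i\<close> changes
  the integral by at most the L1 distance of the two, uniformly in n. Dominated convergence makes
  this distance small, so \<open>i\<close> can be fixed before \<open>n\<close> grows.\<close>

lemma tendsto_integral_mult_zero_lim:
  fixes T :: "nat \<Rightarrow> 'b \<Rightarrow> real" and s :: "nat \<Rightarrow> 'b \<Rightarrow> real"
  assumes T: "\<And>n. T n \<in> borel_measurable N" "\<And>n x. x \<in> space N \<Longrightarrow> \<bar>T n x\<bar> \<le> 1"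
    and s: "\<And>i. integrable N (s i)" "\<And>i. (\<lambda>n. \<integral>x. s i x * T n x \<partial>N) \<longlonglongrightarrow> 0"
    and lim: "\<And>x. x \<in> space N \<Longrightarrow> (\<lambda>i. s i x) \<longlonglongrightarrow> f x"
    and dom: "\<And>i x. x \<in> space N \<Longrightarrow> \<bar>s i x\<bar> \<le> w x" "integrable N w"
    and f: "integrable N f"
  shows "(\<lambda>n. \<integral>x. f x * T n x \<partial>N) \<longlonglongrightarrow> 0"
proof (rule tendstoI)
  fix e :: real assume e: "e > 0"
  have int: "integrable N (\<lambda>x. g x * T n x)" if "integrable N g" for g n
    using that T by (intro Bochner_Integration.integrable_bound[OF that])
      (auto simp: abs_mult mult_left_le intro!: AE_I2)
  have "(\<lambda>i. \<integral>x. \<bar>f x - s i x\<bar> \<partial>N) \<longlonglongrightarrow> (\<integral>x. 0 \<partial>N)"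
  proof (rule integral_dominated_convergence[where w = "\<lambda>x. \<bar>f x\<bar> + w x"])
    show "AE x in N. (\<lambda>i. \<bar>f x - s i x\<bar>) \<longlonglongrightarrow> 0"
    proof (rule AE_I2)
      fix x assume "x \<in> space N"
      from tendsto_rabs[OF tendsto_diff[OF tendsto_const[of "f x"] lim[OF this]]]
      show "(\<lambda>i. \<bar>f x - s i x\<bar>) \<longlonglongrightarrow> 0" by simp
    qed
    show "AE x in N. norm \<bar>f x - s i x\<bar> \<le> \<bar>f x\<bar> + w x" for i
    proof (rule AE_I2)
      fix x assume "x \<in> space N"
      from dom(1)[OF this, of i] show "norm \<bar>f x - s i x\<bar> \<le> \<bar>f x\<bar> + w x" by simp
    qed
  qed (use f s(1) dom(2) in auto)
  then have "\<forall>\<^sub>F i in sequentially. (\<integral>x. \<bar>f x - s i x\<bar> \<partial>N) < e / 2"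
    using e by (intro order_tendstoD(2)) auto
  then obtain i where i: "(\<integral>x. \<bar>f x - s i x\<bar> \<partial>N) < e / 2"
    by (auto simp: eventually_sequentially)
  have "\<forall>\<^sub>F n in sequentially. \<bar>\<integral>x. s i x * T n x \<partial>N\<bar> < e / 2"
    using tendstoD[OF s(2)[of i], of "e / 2"] e by simp
  then show "\<forall>\<^sub>F n in sequentially. dist (\<integral>x. f x * T n x \<partial>N) 0 < e"
  proof (rule eventually_mono)
    fix n assume n: "\<bar>\<integral>x. s i x * T n x \<partial>N\<bar> < e / 2"
    have d: "integrable N (\<lambda>x. f x - s i x)" using f s(1) by simp
    have "(\<integral>x. f x * T n x \<partial>N) = (\<integral>x. (f x - s i x) * T n x \<partial>N) + (\<integral>x. s i x * T n x \<partial>N)"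
      unfolding Bochner_Integration.integral_add[OF int[OF d] int[OF s(1)], symmetric]
      by (simp add: algebra_simps)
    moreover have "norm (\<integral>x. (f x - s i x) * T n x \<partial>N) \<le> (\<integral>x. \<bar>f x - s i x\<bar> \<partial>N)"
    proof (rule integral_norm_bound[THEN order_trans], rule integral_mono)
      show "integrable N (\<lambda>x. norm ((f x - s i x) * T n x))"
        by (rule integrable_norm[OF int[OF d]])
      show "integrable N (\<lambda>x. \<bar>f x - s i x\<bar>)" using d by simp
      show "norm ((f x - s i x) * T n x) \<le> \<bar>f x - s i x\<bar>" if "x \<in> space N" for x
        using T(2)[OF that, of n] by (simp add: abs_mult mult_left_le)
    qed
    ultimately show "dist (\<integral>x. f x * T n x \<partial>N) 0 < e" using i n by simp
  qed
qed

text \<open>The sets whose indicators satisfy the claim form a Dynkin system containing the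
  pi-system \<open>G\<close>, hence all of \<open>sets N\<close>. Linearity and dominated limits
  carry the claim on to integrable functions.\<close>

lemma tendsto_integral_mult_zero_of_generator:
  fixes T :: "nat \<Rightarrow> 'b \<Rightarrow> real"
  assumes N: "finite_measure N"
    and T: "\<And>n. T n \<in> borel_measurable N" "\<And>n x. x \<in> space N \<Longrightarrow> \<bar>T n x\<bar> \<le> 1"
    and G: "Int_stable G" "G \<subseteq> Pow (space N)" "space N \<in> G" "sets N = sigma_sets (space N) G"
    and base: "\<And>A. A \<in> G \<Longrightarrow> (\<lambda>n. \<integral>x. indicator A x * T n x \<partial>N) \<longlonglongrightarrow> 0"
    and g: "integrable N g"
  shows "(\<lambda>n. \<integral>x. g x * T n x \<partial>N) \<longlonglongrightarrow> 0"
proof -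
  interpret finite_measure N by fact
  have int: "integrable N (\<lambda>x. g x * T n x)" if "integrable N g" for g n
    using that T by (intro Bochner_Integration.integrable_bound[OF that])
      (auto simp: abs_mult mult_left_le intro!: AE_I2)
  have ind: "integrable N (indicator A :: 'b \<Rightarrow> real)" if "A \<in> sets N" for A
    using that by (simp add: integrable_indicator_iff less_top[symmetric])
  have set: "(\<lambda>n. \<integral>x. indicator A x * T n x \<partial>N) \<longlonglongrightarrow> 0" if "A \<in> sets N" for A
  proof -
    have "A \<in> sigma_sets (space N) G" using that G(4) by simp
    from G(1,2) this show ?thesis
    proof (induction rule: sigma_sets_induct_disjoint)
      case (basic A)
      then show ?case by (rule base)
    next
      case empty
      show ?case by simp
    next
      case (compl A)
      have A: "A \<in> sets N" using compl(1) G(4) by simp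
      have "(\<integral>x. indicator (space N - A) x * T n x \<partial>N) =
          (\<integral>x. indicator (space N) x * T n x \<partial>N) - (\<integral>x. indicator A x * T n x \<partial>N)" for n
        unfolding Bochner_Integration.integral_diff[OF int[OF ind[OF sets.top]] int[OF ind[OF A]],
          symmetric]
        by (intro Bochner_Integration.integral_cong) (auto simp: indicator_def)
      then show ?case using tendsto_diff[OF base[OF G(3)] compl(2)] by simp
    next
      case (union A)
      have A: "A i \<in> sets N" for i using union(2) G(4) by auto
      \<comment> \<open>The induction speaks of the single disjoint sets. Finite unions follow by
        additivity, and the countable union is a dominated limit of them.\<close>
      have part: "(\<lambda>n. \<integral>x. indicator (\<Union>i<m. A i) x * T n x \<partial>N) \<longlonglongrightarrow> 0" for m :: nat
      proof (induction m)
        case 0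
        show ?case by simp
      next
        case (Suc m)
        have disj: "x \<notin> A i" if "x \<in> A m" "i < m" for i x
        proof -
          have "A m \<inter> A i = {}"
            by (rule disjoint_family_onD[OF union(1)]) (use that(2) in auto)
          then show ?thesis using that(1) by blast
        qed
        have split: "indicator (\<Union>i<Suc m. A i) x =
            (indicator (\<Union>i<m. A i) x + indicator (A m) x :: real)" for x
          using disj[of x] by (auto simp: indicator_def less_Suc_eq)
        have Un: "(\<Union>i<m. A i) \<in> sets N" using A by auto
        have "(\<integral>x. indicator (\<Union>i<Suc m. A i) x * T n x \<partial>N) =
            (\<integral>x. indicator (\<Union>i<m. A i) x * T n x \<partial>N) + (\<integral>x. indicator (A m) x * T n x \<partial>N)" for n
          unfolding split distrib_right
          by (rule Bochner_Integration.integral_add[OF int[OF ind[OF Un]] int[OF ind[OF A]]])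
        then show ?case using tendsto_add[OF Suc union(3)[of m]] by simp
      qed
      show ?case
      proof (rule tendsto_integral_mult_zero_lim[OF T _ part])
        show "(\<lambda>i. indicator (\<Union>i<i. A i) x :: real) \<longlonglongrightarrow> indicator (\<Union>i. A i) x" for x
          by (rule LIMSEQ_indicator_UN)
        show "integrable N (\<lambda>_. 1 :: real)" by simp
        show "\<bar>indicator (\<Union>i<m. A i) x :: real\<bar> \<le> 1" for m :: nat and x
          by (simp add: indicator_def)
        show "integrable N (indicator (\<Union>i<m. A i) :: 'b \<Rightarrow> real)" for m :: nat
          using A by (intro ind) auto
        show "integrable N (indicator (\<Union>i. A i) :: 'b \<Rightarrow> real)"
          using A by (intro ind) auto
      qed
    qed
  qed
  from g show ?thesis
  proof (induction rule: integrable_induct)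
    case (base A c)
    have "(\<integral>x. indicator A x *\<^sub>R c * T n x \<partial>N) = c * (\<integral>x. indicator A x * T n x \<partial>N)" for n
      by (subst integral_mult_right_zero[symmetric]) (simp add: mult_ac)
    then show ?case using tendsto_mult_right_zero[OF set[OF base(1)], of c] by simp
  next
    case (add f g)
    have "(\<integral>x. (f x + g x) * T n x \<partial>N) = (\<integral>x. f x * T n x \<partial>N) + (\<integral>x. g x * T n x \<partial>N)" for n
      by (simp add: distrib_right int add.hyps)
    then show ?case using tendsto_add[OF add.IH] by simp
  next
    case (lim f s)
    show ?case
      \<comment> \<open>The factor 2 is the domination that \<open>integrable_induct\<close>
        provides for the approximating functions.\<close>
      by (rule tendsto_integral_mult_zero_lim[OF T lim.hyps(1) lim.IH lim.hyps(2), where w = "\<lambda>x. 2 * norm (f x)"])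
         (use lim.hyps(3,4) in auto)
  qed
qed

section \<open>The cut norm as a bound for bilinear forms\<close>

text \<open>A real infimum can be approximated only over a nonempty set; the identity is a witness
  that \<open>inv_mp\<close> rearrangements exist.\<close>

lemma cut_dist_lessD:
  assumes "cut_dist M U W < c"
  obtains \<phi> where "inv_mp M \<phi>" "cut_norm M (\<lambda>x y. U x y - W (\<phi> x) (\<phi> y)) < c"
proof -
  have id: "the_inv_into (space M) id x = x" if "x \<in> space M" for x
    using the_inv_into_f_f[of id "space M" x] that by simp
  have "the_inv_into (space M) id \<in> M \<rightarrow>\<^sub>M M"
    using measurable_cong[of M "the_inv_into (space M) id" "\<lambda>x. x" M] id by simp
  then have "inv_mp M id" by (simp add: inv_mp_def distr_id[unfolded id_def] id_def bij_betw_def)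
  then have "(\<lambda>\<phi>. cut_norm M (\<lambda>x y. U x y - W (\<phi> x) (\<phi> y))) ` {\<phi>. inv_mp M \<phi>} \<noteq> {}" by blast
  from cInf_lessD[OF this] assms that show ?thesis
    unfolding cut_dist_def by blast
qed

text \<open>A Borel measure has the whole type as its space. Fixing this once removes the membership
  conditions for points of \<open>M\<close>; for products they remain, because their elements are
  extensional functions.\<close>

locale full_prob_space = prob_space M for M :: "'a measure" +
  assumes space_UNIV [simp]: "space M = UNIV"
begin

sublocale pair: pair_prob_space M M
  by unfold_locales

sublocale P: product_prob_space "\<lambda>_ :: nat. M"
  by unfold_locales

abbreviation Pw :: "nat set \<Rightarrow> (nat \<Rightarrow> 'a) measure" where
  "Pw I \<equiv> PiM I (\<lambda>_. M)"

text \<open>Relaxed indicator functions: vertex weights, sections of graphons and the scaling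
  factors of tilings are all of this kind.\<close>

definition unit_fun :: "('a \<Rightarrow> real) \<Rightarrow> bool" where
  "unit_fun u \<longleftrightarrow> u \<in> borel_measurable M \<and> (\<forall>x. 0 \<le> u x \<and> u x \<le> 1)"

text \<open>The kernel of interest is the difference of two graphons, whose values lie between -1
  and 1.\<close>

definition bdd_kernel :: "('a \<Rightarrow> 'a \<Rightarrow> real) \<Rightarrow> bool" where
  "bdd_kernel V \<longleftrightarrow> (\<lambda>(x, y). V x y) \<in> borel_measurable (M \<Otimes>\<^sub>M M) \<and> (\<forall>x y. \<bar>V x y\<bar> \<le> 1)"

section \<open>Elementary facts on weights and kernels\<close>

lemma unit_fun_measurable [measurable_dest]: "unit_fun u \<Longrightarrow> u \<in> borel_measurable M"
  by (simp add: unit_fun_def)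

lemma unit_fun_nonneg: "unit_fun u \<Longrightarrow> 0 \<le> u x"
  and unit_fun_le_1: "unit_fun u \<Longrightarrow> u x \<le> 1"
  by (simp_all add: unit_fun_def)

lemma unit_fun_abs: "unit_fun u \<Longrightarrow> \<bar>u x\<bar> \<le> 1"
  by (simp add: unit_fun_def)

lemma unit_fun_mult: "unit_fun u \<Longrightarrow> unit_fun v \<Longrightarrow> unit_fun (\<lambda>x. u x * v x)"
  by (auto simp: unit_fun_def intro: mult_le_one)

lemma unit_fun_indicator: "A \<in> sets M \<Longrightarrow> unit_fun (indicator A)"
  by (simp add: unit_fun_def indicator_le_1)

lemma unit_fun_const: "0 \<le> c \<Longrightarrow> c \<le> 1 \<Longrightarrow> unit_fun (\<lambda>_. c)"
  by (simp add: unit_fun_def)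

lemma bdd_kernel_measurable:
  "bdd_kernel V \<Longrightarrow> (\<lambda>p. V (fst p) (snd p)) \<in> borel_measurable (M \<Otimes>\<^sub>M M)"
  by (simp add: bdd_kernel_def case_prod_unfold)

lemma bdd_kernel_case_prod: "bdd_kernel V \<Longrightarrow> case_prod V \<in> borel_measurable (M \<Otimes>\<^sub>M M)"
  by (simp add: bdd_kernel_def)

lemma bdd_kernel_compose:
  assumes "bdd_kernel V" "f \<in> N \<rightarrow>\<^sub>M M" "g \<in> N \<rightarrow>\<^sub>M M"
  shows "(\<lambda>x. V (f x) (g x)) \<in> borel_measurable N"
  using measurable_compose[OF measurable_Pair[OF assms(2,3)] bdd_kernel_measurable[OF assms(1)]]
  by simp

lemma bdd_kernel_abs: "bdd_kernel V \<Longrightarrow> \<bar>V x y\<bar> \<le> 1"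
  by (simp add: bdd_kernel_def)

lemma bdd_kernel_uminus: "bdd_kernel V \<Longrightarrow> bdd_kernel (\<lambda>x y. - V x y)"
  unfolding bdd_kernel_def by (auto simp: case_prod_unfold)

lemma graphon_nonneg: "graphon M U \<Longrightarrow> 0 \<le> U x y"
  and graphon_le_1: "graphon M U \<Longrightarrow> U x y \<le> 1"
  by (simp_all add: graphon_def)

lemma graphon_bdd_kernel: "graphon M U \<Longrightarrow> bdd_kernel U"
  by (auto simp: graphon_def bdd_kernel_def)

lemma graphon_diff_bdd_kernel:
  assumes "graphon M U" "graphon M W"
  shows "bdd_kernel (\<lambda>x y. U x y - W x y)"
proof -
  have "\<bar>U x y - W x y\<bar> \<le> 1" for x y
    using graphon_nonneg[OF assms(1), of x y] graphon_le_1[OF assms(1), of x y]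
      graphon_nonneg[OF assms(2), of x y] graphon_le_1[OF assms(2), of x y] by linarith
  moreover have "(\<lambda>(x, y). U x y - W x y) \<in> borel_measurable (M \<Otimes>\<^sub>M M)"
    using assms[THEN graphon_bdd_kernel, THEN bdd_kernel_measurable] by (simp add: case_prod_unfold)
  ultimately show ?thesis by (simp add: bdd_kernel_def)
qed

lemma prob_UNIV [simp]: "measure M UNIV = 1"
  using prob_space by simp

section \<open>Extremal weights for linear and bilinear forms\<close>

lemma pos_set_measurable: "h \<in> borel_measurable M \<Longrightarrow> {x. (h x :: real) > 0} \<in> sets M"
  using borel_measurable_less[of "\<lambda>_. 0" M h] by simp

text \<open>Pointwise, a factor in [0,1] raises \<open>h x * u x\<close> at most to the positive
  part of \<open>h x\<close>, and the indicator of the set where \<open>h\<close> is positive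
  attains it.\<close>

lemma integral_mult_unit_le_pos_part:
  assumes h: "h \<in> borel_measurable M" "\<And>x. \<bar>h x\<bar> \<le> 1" and u: "unit_fun u"
  shows "(\<integral>x. h x * u x \<partial>M) \<le> (\<integral>x. h x * indicator {x. h x > 0} x \<partial>M)"
proof (rule integral_mono)
  have m: "{x. h x > 0} \<in> sets M" by (rule pos_set_measurable[OF h(1)])
  have *: "integrable M (\<lambda>x. h x * w x)" if w: "unit_fun w" for w
    by (rule integrable_const_bound[where B = 1])
       (use h unit_fun_measurable[OF w] unit_fun_abs[OF w] in
         \<open>auto simp: abs_mult intro!: mult_le_one\<close>)
  show "integrable M (\<lambda>x. h x * u x)"
    "integrable M (\<lambda>x. h x * indicator {x. h x > 0} x)"
    using *[OF u] *[OF unit_fun_indicator[OF m]] by auto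
  show "h x * u x \<le> h x * indicator {x. h x > 0} x" for x
    using unit_fun_nonneg[OF u, of x] unit_fun_le_1[OF u, of x]
    by (cases "h x > 0") (auto simp: mult_nonpos_nonneg mult_left_le)
qed

lemma kernel_integral_snd:
  assumes V: "bdd_kernel V" and v: "unit_fun v"
  shows "(\<lambda>x. \<integral>y. V x y * v y \<partial>M) \<in> borel_measurable M" "\<bar>\<integral>y. V x y * v y \<partial>M\<bar> \<le> 1"
proof -
  note [measurable] = bdd_kernel_case_prod[OF V] unit_fun_measurable[OF v]
  show "(\<lambda>x. \<integral>y. V x y * v y \<partial>M) \<in> borel_measurable M"
    by measurable
  have "\<bar>V x y * v y\<bar> \<le> 1" for y
    using bdd_kernel_abs[OF V, of x y] unit_fun_abs[OF v, of y]
    by (auto simp: abs_mult intro!: mult_le_one)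
  moreover have "integrable M (\<lambda>y. V x y * v y)"
    by (rule integrable_const_bound[where B = 1]) (use calculation in auto)
  ultimately have "norm (\<integral>y. V x y * v y \<partial>M) \<le> (\<integral>y. 1 \<partial>M)"
    by (intro integral_norm_bound[THEN order_trans] integral_mono) auto
  then show "\<bar>\<integral>y. V x y * v y \<partial>M\<bar> \<le> 1" by simp
qed

lemma bdd_kernel_swap: "bdd_kernel V \<Longrightarrow> bdd_kernel (\<lambda>x y. V y x)"
  using measurable_pair_swap[of "case_prod V" M M borel] by (simp add: bdd_kernel_def)

lemma kernel_integrable:
  assumes V: "bdd_kernel V" and "unit_fun u" "unit_fun v"
  shows "integrable (M \<Otimes>\<^sub>M M) (\<lambda>(x, y). V x y * (u x * v y))"
proof (rule pair.P.integrable_const_bound[where B = 1])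
  show "AE p in M \<Otimes>\<^sub>M M. norm (case p of (x, y) \<Rightarrow> V x y * (u x * v y)) \<le> 1"
  proof (intro AE_I2)
    fix p
    show "norm (case p of (x, y) \<Rightarrow> V x y * (u x * v y)) \<le> 1"
      using bdd_kernel_abs[OF V, of "fst p" "snd p"] unit_fun_abs[OF assms(2), of "fst p"]
        unit_fun_abs[OF assms(3), of "snd p"]
      by (auto simp: case_prod_unfold abs_mult intro!: mult_le_one)
  qed
  note [measurable] = bdd_kernel_case_prod[OF V] assms(2,3)[THEN unit_fun_measurable]
  show "(\<lambda>(x, y). V x y * (u x * v y)) \<in> borel_measurable (M \<Otimes>\<^sub>M M)"
    by measurable
qed

text \<open>For fixed \<open>v\<close> the form is linear in \<open>u\<close>, so it is maximised by an indicator function;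
  the same then applies to \<open>v\<close>.\<close>
lemma bilinear_le_of_rectangles:
  assumes V: "bdd_kernel V" and u: "unit_fun u" and v: "unit_fun v"
    and c: "\<And>A B. A \<in> sets M \<Longrightarrow> B \<in> sets M \<Longrightarrow>
      (\<integral>x. \<integral>y. V x y * (indicator A x * indicator B y) \<partial>M \<partial>M) \<le> c"
  shows "(\<integral>x. \<integral>y. V x y * (u x * v y) \<partial>M \<partial>M) \<le> c"
proof -
  define h where "h x = (\<integral>y. V x y * v y \<partial>M)" for x
  define A where "A = {x. h x > 0}"
  have pull: "(\<integral>y. V x y * (a * v y) \<partial>M) = h x * a" for x a
  proof -
    have "(\<lambda>y. V x y * (a * v y)) = (\<lambda>y. V x y * v y * a)" by (auto simp: mult_ac)
    then show ?thesis by (simp add: h_def)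
  qed
  note h = kernel_integral_snd[OF V v, folded h_def]
  have A: "A \<in> sets M" unfolding A_def by (rule pos_set_measurable[OF h(1)])
  note uA = unit_fun_indicator[OF A]
  define h' where "h' y = (\<integral>x. V x y * indicator A x \<partial>M)" for y
  define B where "B = {y. h' y > 0}"
  note h' = kernel_integral_snd[OF bdd_kernel_swap[OF V] uA, folded h'_def]
  have B: "B \<in> sets M" unfolding B_def by (rule pos_set_measurable[OF h'(1)])
  note uB = unit_fun_indicator[OF B]
  \<comment> \<open>Exchanging the order of integration exhibits the form as linear in the second
    weight, with density \<open>h'\<close>.\<close>
  have swap: "(\<integral>x. \<integral>y. V x y * (indicator A x * w y) \<partial>M \<partial>M) = (\<integral>y. h' y * w y \<partial>M)"
    if "unit_fun w" for w
    using pair.Fubini_integral[OF kernel_integrable[OF V uA that]]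
    by (simp add: h'_def mult.assoc[symmetric])
  have "(\<integral>x. \<integral>y. V x y * (u x * v y) \<partial>M \<partial>M) = (\<integral>x. h x * u x \<partial>M)"
    by (simp add: pull)
  also have "\<dots> \<le> (\<integral>x. h x * indicator A x \<partial>M)"
    unfolding A_def by (rule integral_mult_unit_le_pos_part[OF h u])
  also have "\<dots> = (\<integral>x. \<integral>y. V x y * (indicator A x * v y) \<partial>M \<partial>M)"
    by (simp add: pull)
  also have "\<dots> = (\<integral>y. h' y * v y \<partial>M)" by (rule swap[OF v])
  also have "\<dots> \<le> (\<integral>y. h' y * indicator B y \<partial>M)"
    unfolding B_def by (rule integral_mult_unit_le_pos_part[OF h' v])
  also have "\<dots> = (\<integral>x. \<integral>y. V x y * (indicator A x * indicator B y) \<partial>M \<partial>M)"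
    by (rule swap[OF uB, symmetric])
  also have "\<dots> \<le> c" by (rule c[OF A B])
  finally show ?thesis .
qed

text \<open>Iterated form of the integrals in \<open>cut_norm\<close>, in which one variable can be
  frozen while the other is optimised.\<close>

lemma rectangle_integral_eq:
  assumes V: "bdd_kernel V" and "A \<in> sets M" "B \<in> sets M"
  shows "(LINT p : (A \<times> B) | (M \<Otimes>\<^sub>M M). V (fst p) (snd p)) =
    (\<integral>x. \<integral>y. V x y * (indicator A x * indicator B y) \<partial>M \<partial>M)"
  using pair.integral_fst'[OF kernel_integrable[OF V assms(2,3)[THEN unit_fun_indicator]]]
  unfolding set_lebesgue_integral_def
  by (simp add: case_prod_unfold indicator_times mult_ac)

lemma cut_norm_le:
  assumes V: "bdd_kernel V"
    and c: "\<And>A B. A \<in> sets M \<Longrightarrow> B \<in> sets M \<Longrightarrow>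
      \<bar>\<integral>x. \<integral>y. V x y * (indicator A x * indicator B y) \<partial>M \<partial>M\<bar> \<le> c"
  shows "cut_norm M V \<le> c"
  unfolding cut_norm_def
proof (rule cSUP_least)
  fix AB assume "AB \<in> sets M \<times> sets M"
  then have AB: "fst AB \<in> sets M" "snd AB \<in> sets M" by auto
  show "\<bar>LINT p : (fst AB \<times> snd AB) | (M \<Otimes>\<^sub>M M). V (fst p) (snd p)\<bar> \<le> c"
    using c[OF AB] by (simp only: rectangle_integral_eq[OF V AB])
qed auto

text \<open>The supremum in \<open>cut_norm\<close> is taken in the reals, so a bound for the whole
  family has to be exhibited first. A kernel bounded by 1 on a probability space gives the bound
  1.\<close>

lemma rectangle_le_cut_norm:
  assumes V: "bdd_kernel V" and A: "A \<in> sets M" and B: "B \<in> sets M"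
  shows "\<bar>\<integral>x. \<integral>y. V x y * (indicator A x * indicator B y) \<partial>M \<partial>M\<bar> \<le> cut_norm M V"
proof -
  have bd: "\<bar>LINT p : (A \<times> B) | (M \<Otimes>\<^sub>M M). V (fst p) (snd p)\<bar> \<le> 1"
    if AB: "A \<in> sets M" "B \<in> sets M" for A B
  proof -
    have I: "integrable (M \<Otimes>\<^sub>M M) (\<lambda>p. V (fst p) (snd p) * (indicator A (fst p) * indicator B (snd p)))"
      using kernel_integrable[OF V that[THEN unit_fun_indicator]] by (simp add: case_prod_unfold)
    then have "norm (LINT p|(M \<Otimes>\<^sub>M M). V (fst p) (snd p) * (indicator A (fst p) * indicator B (snd p)))
        \<le> (LINT p|(M \<Otimes>\<^sub>M M). 1)"
      using bdd_kernel_abs[OF V]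
      by (intro integral_norm_bound[THEN order_trans] integral_mono[OF integrable_norm[OF I]])
         (auto simp: abs_mult indicator_def)
    then show ?thesis
      unfolding set_lebesgue_integral_def
      by (simp add: case_prod_unfold indicator_times mult_ac pair.P.prob_space)
  qed
  have "bdd_above ((\<lambda>AB. \<bar>LINT p : (fst AB \<times> snd AB) | (M \<Otimes>\<^sub>M M). V (fst p) (snd p)\<bar>)
      ` (sets M \<times> sets M))"
    by (rule bdd_aboveI[of _ 1]) (use bd in auto)
  then have "\<bar>LINT p : (A \<times> B) | (M \<Otimes>\<^sub>M M). V (fst p) (snd p)\<bar> \<le> cut_norm M V"
    unfolding cut_norm_def using cSUP_upper[of "(A, B)" "sets M \<times> sets M"
      "\<lambda>AB. \<bar>LINT p : (fst AB \<times> snd AB) | (M \<Otimes>\<^sub>M M). V (fst p) (snd p)\<bar>"] A B by auto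
  then show ?thesis by (simp only: rectangle_integral_eq[OF V A B])
qed

text \<open>The one-sided maximisation is applied to both \<open>V\<close> and its negative. No
  constant is lost, because the weights are nonnegative.\<close>

lemma bilinear_le_cut_norm:
  assumes V: "bdd_kernel V" and u: "unit_fun u" and v: "unit_fun v"
  shows "\<bar>\<integral>x. \<integral>y. V x y * (u x * v y) \<partial>M \<partial>M\<bar> \<le> cut_norm M V"
proof (rule abs_leI)
  note r = rectangle_le_cut_norm[OF V]
  show "(\<integral>x. \<integral>y. V x y * (u x * v y) \<partial>M \<partial>M) \<le> cut_norm M V"
    by (rule bilinear_le_of_rectangles[OF V u v]) (rule order_trans[OF abs_ge_self r])
  have neg: "(\<integral>x. \<integral>y. - V x y * (indicator A x * indicator B y) \<partial>M \<partial>M) \<le> cut_norm M V"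
    if "A \<in> sets M" "B \<in> sets M" for A B
    using order_trans[OF abs_ge_minus_self r[OF that]] by simp
  have "(\<integral>x. \<integral>y. - V x y * (u x * v y) \<partial>M \<partial>M) \<le> cut_norm M V"
    by (rule bilinear_le_of_rectangles[OF bdd_kernel_uminus[OF V] u v]) (rule neg)
  then show "- (\<integral>x. \<integral>y. V x y * (u x * v y) \<partial>M \<partial>M) \<le> cut_norm M V" by simp
qed

section \<open>Counting with vertex weights\<close>

lemma prob_space_Pw: "prob_space (Pw I)"
  by (rule prob_space_PiM) (rule prob_space_axioms)

lemma integrable_Pw_bdd:
  fixes C :: real
  assumes "f \<in> borel_measurable (Pw I)" "\<And>x. x \<in> space (Pw I) \<Longrightarrow> \<bar>f x\<bar> \<le> C"
  shows "integrable (Pw I) f"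
  using assms
  by (intro finite_measure.integrable_const_bound[OF prob_space.finite_measure[OF prob_space_Pw]]
      AE_I2[of "Pw I" "\<lambda>x. norm (f x) \<le> C"]) auto

text \<open>The product structure that the cut norm can test once all coordinates but
  \<open>i\<close> and \<open>j\<close> are frozen at \<open>z\<close>. The factors may depend on
  \<open>z\<close> arbitrarily; measurability of \<open>R\<close> is a separate assumption where it
  matters.\<close>

definition splits :: "nat \<Rightarrow> nat \<Rightarrow> ((nat \<Rightarrow> 'a) \<Rightarrow> real) \<Rightarrow> bool" where
  "splits i j R \<longleftrightarrow> (\<forall>z. \<exists>u v. unit_fun u \<and> unit_fun v \<and>
     (\<forall>a b. R (z(i := a, j := b)) = u a * v b))"

lemma splits_mult:
  assumes "splits i j R" "splits i j S"
  shows "splits i j (\<lambda>x. R x * S x)"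
  unfolding splits_def
proof
  fix z
  obtain u v where R: "unit_fun u" "unit_fun v" "\<And>a b. R (z(i := a, j := b)) = u a * v b"
    using assms(1) unfolding splits_def by meson
  obtain u' v' where S: "unit_fun u'" "unit_fun v'" "\<And>a b. S (z(i := a, j := b)) = u' a * v' b"
    using assms(2) unfolding splits_def by meson
  show "\<exists>u v. unit_fun u \<and> unit_fun v \<and>
      (\<forall>a b. R (z(i := a, j := b)) * S (z(i := a, j := b)) = u a * v b)"
    by (rule exI[of _ "\<lambda>a. u a * u' a"], rule exI[of _ "\<lambda>a. v a * v' a"])
       (use R S unit_fun_mult in \<open>auto simp: mult_ac\<close>)
qed

lemma splits_const: "0 \<le> c \<Longrightarrow> c \<le> 1 \<Longrightarrow> splits i j (\<lambda>_. c)"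
  unfolding splits_def
  by (intro allI exI[of _ "\<lambda>_. c"] exI[of _ "\<lambda>_. 1"]) (simp add: unit_fun_const)

lemma splits_prod:
  "(\<And>e. e \<in> D \<Longrightarrow> splits i j (R e)) \<Longrightarrow> splits i j (\<lambda>x. \<Prod>e\<in>D. R e x)"
  by (induction D rule: infinite_finite_induct) (auto intro: splits_mult splits_const)

lemma splitsI:
  assumes "\<And>z. \<exists>u. unit_fun u \<and> ((\<forall>a b. R (z(i := a, j := b)) = u a) \<or> (\<forall>a b. R (z(i := a, j := b)) = u b))"
  shows "splits i j R"
  unfolding splits_def
proof
  fix z
  obtain u where u: "unit_fun u"
    "(\<forall>a b. R (z(i := a, j := b)) = u a) \<or> (\<forall>a b. R (z(i := a, j := b)) = u b)"
    using assms by blast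
  from u(2) show "\<exists>u v. unit_fun u \<and> unit_fun v \<and> (\<forall>a b. R (z(i := a, j := b)) = u a * v b)"
  proof
    assume "\<forall>a b. R (z(i := a, j := b)) = u a"
    then show ?thesis
      by (intro exI[of _ u] exI[of _ "\<lambda>_. 1"]) (simp add: u(1) unit_fun_const)
  next
    assume "\<forall>a b. R (z(i := a, j := b)) = u b"
    then show ?thesis
      by (intro exI[of _ "\<lambda>_. 1"] exI[of _ u]) (simp add: u(1) unit_fun_const)
  qed
qed

lemma splits_coord:
  assumes "i \<noteq> j" "unit_fun h"
  shows "splits i j (\<lambda>x. h (x l))"
proof (rule splitsI)
  fix z
  consider "l = i" | "l = j" | "l \<noteq> i" "l \<noteq> j" by blast
  then show "\<exists>u. unit_fun u \<and> ((\<forall>a b. h ((z(i := a, j := b)) l) = u a) \<or>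
      (\<forall>a b. h ((z(i := a, j := b)) l) = u b))"
  proof cases
    case 3
    then show ?thesis
      by (intro exI[of _ "\<lambda>_. h (z l)"])
         (simp add: unit_fun_const unit_fun_nonneg[OF assms(2)] unit_fun_le_1[OF assms(2)])
  qed (use assms in auto)
qed

lemma unit_fun_section:
  assumes "graphon M U"
  shows "unit_fun (\<lambda>a. U a c)" "unit_fun (\<lambda>a. U c a)"
proof -
  note V = bdd_kernel_compose[OF graphon_bdd_kernel[OF assms]]
  have "(\<lambda>a. U a c) \<in> borel_measurable M" "(\<lambda>a. U c a) \<in> borel_measurable M"
    by (rule V; simp)+
  then show "unit_fun (\<lambda>a. U a c)" "unit_fun (\<lambda>a. U c a)"
    using graphon_nonneg[OF assms] graphon_le_1[OF assms] by (simp_all add: unit_fun_def)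
qed

text \<open>An edge other than {i, j} shares at most one vertex with it, so its factor depends on at
  most one of the two free coordinates and is a section of \<open>U\<close> or a constant.\<close>

lemma splits_edge:
  assumes ij: "i \<noteq> j" and pq: "p \<noteq> q" and ne: "{p, q} \<noteq> {i, j}" and U: "graphon M U"
  shows "splits i j (\<lambda>x. U (x p) (x q))"
proof (rule splitsI)
  fix z
  let ?G = "\<lambda>u. unit_fun u \<and> ((\<forall>a b. U ((z(i := a, j := b)) p) ((z(i := a, j := b)) q) = u a) \<or>
      (\<forall>a b. U ((z(i := a, j := b)) p) ((z(i := a, j := b)) q) = u b))"
  consider "p \<in> {i, j}" "q \<notin> {i, j}" | "p \<notin> {i, j}" "q \<in> {i, j}" | "p \<notin> {i, j}" "q \<notin> {i, j}"
    using ij pq ne by blast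
  then show "\<exists>u. ?G u"
  proof cases
    case 1
    then have "?G (\<lambda>a. U a (z q))" using unit_fun_section(1)[OF U, of "z q"] ij by auto
    then show ?thesis by blast
  next
    case 2
    then have "?G (\<lambda>a. U (z p) a)" using unit_fun_section(2)[OF U, of "z p"] ij by auto
    then show ?thesis by blast
  next
    case 3
    then have "?G (\<lambda>_. U (z p) (z q))"
      using unit_fun_const[OF graphon_nonneg[OF U] graphon_le_1[OF U], of "z p" "z q" ] by auto
    then show ?thesis by blast
  qed
qed

lemma splits_bounds:
  assumes "splits i j R"
  shows "0 \<le> R x" "R x \<le> 1"
proof -
  obtain u v where uv: "unit_fun u" "unit_fun v" "\<And>a b. R (x(i := a, j := b)) = u a * v b"
    using assms unfolding splits_def by meson
  have "R x = u (x i) * v (x j)" using uv(3)[of "x i" "x j"] by simp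
  then show "0 \<le> R x" "R x \<le> 1"
    using unit_fun_nonneg[OF uv(1)] unit_fun_nonneg[OF uv(2)]
      unit_fun_le_1[OF uv(1)] unit_fun_le_1[OF uv(2)] by (auto intro: mult_le_one)
qed

text \<open>With the coordinates outside {i, j} fixed, the double integral over the other two is the
  bilinear form of \<open>V\<close> at two weights, hence bounded by the cut norm. Averaging over
  the fixed coordinates keeps the bound.\<close>

lemma edge_bound:
  assumes I: "finite I" "i \<in> I" "j \<in> I" "i \<noteq> j" and V: "bdd_kernel V"
    and R: "R \<in> borel_measurable (Pw I)" "splits i j R"
  shows "\<bar>\<integral>x. V (x i) (x j) * R x \<partial>Pw I\<bar> \<le> cut_norm M V"
proof -
  define J where "J = I - {i, j}"
  have J: "finite J" "i \<notin> J" "j \<notin> insert i J" "insert j (insert i J) = I"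
    using I by (auto simp: J_def)
  define f where "f x = V (x i) (x j) * R x" for x
  have f1: "\<bar>f x\<bar> \<le> 1" for x
    using bdd_kernel_abs[OF V] splits_bounds[OF R(2), of x]
    unfolding f_def by (auto simp: abs_mult intro!: mult_le_one)
  note [measurable] = bdd_kernel_case_prod[OF V] R(1)
  have fm [measurable]: "f \<in> borel_measurable (Pw I)"
    unfolding f_def using I(2,3) by measurable
  \<comment> \<open>This is stated for an arbitrary probability space because it serves both for a
    single coordinate and for all coordinates in \<open>J\<close>.\<close>
  have bound: "\<bar>\<integral>b. w b \<partial>N\<bar> \<le> c" if "prob_space N" "\<And>b. \<bar>w b\<bar> \<le> c" "w \<in> borel_measurable N"
    for c and w :: "'b \<Rightarrow> real" and N
  proof -
    interpret N: prob_space N by fact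
    have "integrable N w" using that by (intro N.integrable_const_bound[where B = c]) auto
    then have "norm (\<integral>b. w b \<partial>N) \<le> (\<integral>b. c \<partial>N)"
      using that by (intro integral_norm_bound[THEN order_trans] integral_mono) auto
    then show ?thesis by (simp add: N.prob_space)
  qed
  have upd: "(\<lambda>b. x(j := b)) \<in> M \<rightarrow>\<^sub>M Pw I" if "x \<in> space (Pw (insert i J))" for x
    using measurable_component_update[OF that J(3)] J(4) by simp
  define g where "g x = (\<integral>b. f (x(j := b)) \<partial>M)" for x
  have "(\<lambda>(x, b). f (x(j := b))) \<in> borel_measurable (Pw (insert i J) \<Otimes>\<^sub>M M)"
    using measurable_compose[OF measurable_add_dim[of j "insert i J" "\<lambda>_. M"], of f borel] J(4) fm
    by (simp add: case_prod_unfold)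
  then have gm: "g \<in> borel_measurable (Pw (insert i J))"
    unfolding g_def by (rule borel_measurable_lebesgue_integral)
  have g1: "\<bar>g x\<bar> \<le> 1" if "x \<in> space (Pw (insert i J))" for x
    unfolding g_def using f1 measurable_compose[OF upd[OF that] fm]
    by (intro bound) (auto intro: prob_space_axioms)
  have inner: "\<bar>\<integral>a. g (z(i := a)) \<partial>M\<bar> \<le> cut_norm M V" for z
  proof -
    obtain u v where uv: "unit_fun u" "unit_fun v" "\<And>a b. R (z(i := a, j := b)) = u a * v b"
      using R(2) unfolding splits_def by meson
    have "(\<integral>a. g (z(i := a)) \<partial>M) = (\<integral>a. \<integral>b. V a b * (u a * v b) \<partial>M \<partial>M)"
      unfolding g_def f_def using I(4) by (simp add: uv(3))
    then show ?thesis using bilinear_le_cut_norm[OF V uv(1,2)] by simp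
  qed
  have "integrable (Pw I) f"
    by (rule integrable_Pw_bdd[OF fm f1])
  then have "(\<integral>x. f x \<partial>Pw I) = (\<integral>x. g x \<partial>Pw (insert i J))"
    unfolding g_def using P.product_integral_insert[of "insert i J" j f] J by simp
  also have "\<dots> = (\<integral>z. \<integral>a. g (z(i := a)) \<partial>M \<partial>Pw J)"
  proof (rule P.product_integral_insert[OF J(1,2)])
    show "integrable (Pw (insert i J)) g"
      by (rule integrable_Pw_bdd[OF gm g1])
  qed
  finally have eq: "(\<integral>x. f x \<partial>Pw I) = (\<integral>z. \<integral>a. g (z(i := a)) \<partial>M \<partial>Pw J)" .
  have "(\<lambda>(x, b). g (x(i := b))) \<in> borel_measurable (Pw J \<Otimes>\<^sub>M M)"
    using measurable_compose[OF measurable_add_dim[of i J "\<lambda>_. M"], of g borel] gm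
    by (simp add: case_prod_unfold)
  then have "(\<lambda>z. \<integral>a. g (z(i := a)) \<partial>M) \<in> borel_measurable (Pw J)"
    by (rule borel_measurable_lebesgue_integral)
  then show ?thesis
    unfolding f_def[symmetric] eq by (rule bound[OF prob_space_Pw inner])
qed

section \<open>Replacing one graphon by another edge by edge\<close>

lemma cut_norm_nonneg: "bdd_kernel V \<Longrightarrow> 0 \<le> cut_norm M V"
  using rectangle_le_cut_norm[of V "{}" "{}"] by simp

lemma tensor_F_measurable:
  assumes "E \<subseteq> I \<times> I" "graphon M U"
  shows "tensor_F E U \<in> borel_measurable (Pw I)"
proof -
  have "(\<lambda>x. U (x (fst e)) (x (snd e))) \<in> borel_measurable (Pw I)" if "e \<in> E" for e
    using that assms(1)
    by (intro bdd_kernel_compose[OF graphon_bdd_kernel[OF assms(2)]] measurable_component_singleton) auto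
  then show ?thesis unfolding tensor_F_def[abs_def]
    by (auto simp: case_prod_unfold intro!: borel_measurable_prod)
qed

lemma tensor_F_bounds:
  assumes "graphon M U"
  shows "0 \<le> tensor_F E U x" "tensor_F E U x \<le> 1"
  unfolding tensor_F_def case_prod_unfold
  using graphon_nonneg[OF assms] graphon_le_1[OF assms] by (auto intro: prod_nonneg prod_le_1)

text \<open>A telescoping argument. The set \<open>D\<close> collects the edges that already carry
  \<open>W\<close>. Switching one more edge from \<open>U\<close> to \<open>W\<close> costs at most
  one cut norm by \<open>edge_bound\<close>, and leaves the same expression with that edge moved to
  \<open>D\<close>; therefore \<open>D\<close> is arbitrary in the induction.\<close>

lemma counting_aux:
  assumes I: "finite I" and U: "graphon M U" and W: "graphon M W" and h: "\<And>l. unit_fun (h l)"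
    and "finite E" "finite D" "E \<union> D \<subseteq> {(i, j). i < j \<and> i \<in> I \<and> j \<in> I}" "E \<inter> D = {}"
  shows "\<bar>\<integral>x. (\<Prod>l\<in>I. h l (x l)) * tensor_F D W x * (tensor_F E U x - tensor_F E W x) \<partial>Pw I\<bar>
    \<le> card E * cut_norm M (\<lambda>x y. U x y - W x y)"
  using assms(5-)
proof (induction E arbitrary: D rule: finite_induct)
  case empty
  then show ?case by (simp add: tensor_F_def)
next
  case (insert e E)
  obtain i j where e: "e = (i, j)" by (cases e)
  have ij: "i < j" "i \<in> I" "j \<in> I" using insert.prems e by auto
  let ?V = "\<lambda>x y. U x y - W x y"
  let ?H = "\<lambda>x. \<Prod>l\<in>I. h l (x l)"
  have sub: "E \<subseteq> I \<times> I" "D \<subseteq> I \<times> I" using insert.prems by auto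
  have H: "?H \<in> borel_measurable (Pw I)"
    using h by (intro borel_measurable_prod measurable_compose[OF measurable_component_singleton])
      (auto simp: unit_fun_def)
  have H1: "0 \<le> ?H x" "?H x \<le> 1" for x
    using h by (auto simp: unit_fun_def intro!: prod_nonneg prod_le_1)
  \<comment> \<open>\<open>R\<close> is the cofactor of the difference at the edge \<open>e\<close>;
    \<open>S\<close> is the remainder, of the form treated by the induction hypothesis.\<close>
  define R where "R x = ?H x * tensor_F D W x * tensor_F E U x" for x
  define S where "S x = ?H x * tensor_F (Set.insert e D) W x * (tensor_F E U x - tensor_F E W x)" for x
  have sp: "splits i j (tensor_F A X)" if "A \<subseteq> E \<union> D" "graphon M X" for A X
    unfolding tensor_F_def case_prod_unfold
  proof (rule splits_prod)
    fix e' assume e': "e' \<in> A"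
    then have mem: "e' \<in> E \<union> D" using that by blast
    have "E \<union> D \<subseteq> {(i, j). i < j \<and> i \<in> I \<and> j \<in> I}"
      using insert.prems(2) by blast
    then have lt: "fst e' < snd e'" using mem by auto
    have "e' \<noteq> e" using mem insert.hyps(2) insert.prems(3) by auto
    \<comment> \<open>Edges are stored with the smaller vertex first, so distinct pairs are also
      distinct as unordered pairs.\<close>
    then have "{fst e', snd e'} \<noteq> {i, j}"
      using ij(1) e lt by (auto simp: doubleton_eq_iff prod_eq_iff)
    then show "splits i j (\<lambda>x. X (x (fst e')) (x (snd e')))"
      using ij(1) lt that(2) by (intro splits_edge) auto
  qed
  have Rs: "splits i j R" unfolding R_def
    using ij(1) h U W by (intro splits_mult splits_prod splits_coord sp) auto
  have Rm: "R \<in> borel_measurable (Pw I)"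
    unfolding R_def
    by (intro borel_measurable_times H tensor_F_measurable U W sub)
  have Sm: "S \<in> borel_measurable (Pw I)"
    unfolding S_def using sub ij e
    by (intro borel_measurable_times borel_measurable_diff H tensor_F_measurable U W) auto
  have S1: "\<bar>S x\<bar> \<le> 1" for x
  proof -
    have "\<bar>tensor_F E U x - tensor_F E W x\<bar> \<le> 1"
      using tensor_F_bounds[OF U, of E x] tensor_F_bounds[OF W, of E x] by linarith
    then show ?thesis
      unfolding S_def using H1[of x] tensor_F_bounds[OF W, of "Set.insert e D" x]
      by (auto simp: abs_mult intro!: mult_le_one)
  qed
  have Si: "integrable (Pw I) S"
    by (rule integrable_Pw_bdd[OF Sm S1])
  have V: "bdd_kernel ?V" by (rule graphon_diff_bdd_kernel[OF U W])
  have VRi: "integrable (Pw I) (\<lambda>x. ?V (x i) (x j) * R x)"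
  proof (rule integrable_Pw_bdd)
    show "\<bar>?V (x i) (x j) * R x\<bar> \<le> 1" for x
      using bdd_kernel_abs[OF V] splits_bounds[OF Rs]
      by (auto simp: abs_mult intro!: mult_le_one)
    show "(\<lambda>x. ?V (x i) (x j) * R x) \<in> borel_measurable (Pw I)"
      using bdd_kernel_compose[OF V, of "\<lambda>x. x i" "Pw I" "\<lambda>x. x j"] ij Rm
      by (intro borel_measurable_times) auto
  qed
  have nD: "e \<notin> D" "finite D" using insert.prems by auto
  \<comment> \<open>With u, w the values at \<open>e\<close> and P, Q the products over
    \<open>E\<close>, this is uP - wQ = (u - w)P + w(P - Q).\<close>
  have eq: "?H x * tensor_F D W x * (tensor_F (Set.insert e E) U x - tensor_F (Set.insert e E) W x)
      = ?V (x i) (x j) * R x + S x" for x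
    unfolding R_def S_def tensor_F_def using insert.hyps nD e by (simp add: algebra_simps)
  have b1: "\<bar>\<integral>x. ?V (x i) (x j) * R x \<partial>Pw I\<bar> \<le> cut_norm M ?V"
    using ij by (intro edge_bound I V Rm Rs) auto
  have b2: "\<bar>\<integral>x. S x \<partial>Pw I\<bar> \<le> card E * cut_norm M ?V"
    unfolding S_def using insert.prems insert.hyps by (intro insert.IH) auto
  show ?case
    unfolding eq Bochner_Integration.integral_add[OF VRi Si]
    using b1 b2 insert.hyps by (simp add: algebra_simps)
qed

text \<open>Telescoping starts with no edge switched. The bound does not depend on the weights, so
  these may later change with n.\<close>

lemma counting:
  assumes "finite I" "graphon M U" "graphon M W" "\<And>l. unit_fun (h l)"
    and "E \<subseteq> {(i, j). i < j \<and> i \<in> I \<and> j \<in> I}"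
  shows "\<bar>\<integral>x. (\<Prod>l\<in>I. h l (x l)) * (tensor_F E U x - tensor_F E W x) \<partial>Pw I\<bar>
    \<le> card E * cut_norm M (\<lambda>x y. U x y - W x y)"
proof -
  have "finite E"
    by (rule finite_subset[of _ "I \<times> I"]) (use assms in auto)
  then show ?thesis
    using counting_aux[OF assms(1-4), of E "{}"] assms(5) by (simp add: tensor_F_def)
qed

text \<open>The indicator of a box is a product over the coordinates and can be absorbed into the
  vertex weights, so \<open>counting\<close> settles boxes. They generate the product sigma-algebra,
  which gives every integrable \<open>g\<close>. No convergence of the weights \<open>h n\<close> is
  involved.\<close>

lemma tensor_F_tendsto:
  assumes I: "finite I" and U: "\<And>n. graphon M (U n)" and W: "graphon M W"
    and h: "\<And>n l. unit_fun (h n l)"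
    and E: "E \<subseteq> {(i, j). i < j \<and> i \<in> I \<and> j \<in> I}"
    and cut: "(\<lambda>n. cut_norm M (\<lambda>x y. U n x y - W x y)) \<longlonglongrightarrow> 0"
    and g: "integrable (Pw I) g"
  shows "(\<lambda>n. \<integral>x. g x * ((\<Prod>l\<in>I. h n l (x l)) * (tensor_F E (U n) x - tensor_F E W x)) \<partial>Pw I)
    \<longlonglongrightarrow> 0"
proof (rule tendsto_integral_mult_zero_of_generator[where G = "prod_algebra I (\<lambda>_. M)"])
  let ?T = "\<lambda>n x. (\<Prod>l\<in>I. h n l (x l)) * (tensor_F E (U n) x - tensor_F E W x)"
  show "finite_measure (Pw I)" by (rule prob_space.finite_measure[OF prob_space_Pw])
  have sub: "E \<subseteq> I \<times> I" using E by auto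
  show "?T n \<in> borel_measurable (Pw I)" for n
    using h U W sub
    by (intro borel_measurable_times borel_measurable_diff tensor_F_measurable borel_measurable_prod
        measurable_compose[OF measurable_component_singleton]) (auto simp: unit_fun_def)
  show "\<bar>?T n x\<bar> \<le> 1" for n x
  proof -
    have "\<bar>tensor_F E (U n) x - tensor_F E W x\<bar> \<le> 1"
      using tensor_F_bounds[OF U, of E n x] tensor_F_bounds[OF W, of E x] by linarith
    moreover have "\<bar>\<Prod>l\<in>I. h n l (x l)\<bar> \<le> 1"
      using h by (auto simp: unit_fun_def abs_prod intro!: prod_le_1)
    ultimately show ?thesis by (auto simp: abs_mult intro!: mult_le_one)
  qed
  show "Int_stable (prod_algebra I (\<lambda>_. M))" by (rule Int_stable_prod_algebra)
  show "prod_algebra I (\<lambda>_. M) \<subseteq> Pow (space (Pw I))"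
    unfolding space_PiM by (rule prod_algebra_sets_into_space)
  show "space (Pw I) \<in> prod_algebra I (\<lambda>_. M)"
    unfolding space_PiM by (rule space_in_prod_algebra)
  show "sets (Pw I) = sigma_sets (space (Pw I)) (prod_algebra I (\<lambda>_. M))"
    by (simp only: space_PiM sets_PiM)
  show "(\<lambda>n. \<integral>x. indicator A x * ?T n x \<partial>Pw I) \<longlonglongrightarrow> 0"
    if A: "A \<in> prod_algebra I (\<lambda>_. M)" for A
  proof -
    obtain B where B: "A = Pi\<^sub>E I B" "\<And>i. i \<in> I \<Longrightarrow> B i \<in> sets M"
      using prod_algebraE_all[OF A] by (metis Pi_iff)
    \<comment> \<open>Measurability of \<open>B l\<close> is known only for \<open>l\<close> in
      \<open>I\<close>; the value 0 elsewhere makes each \<open>h' n l\<close> a weight.\<close>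
    define h' where "h' n l a = (if l \<in> I then indicator (B l) a * h n l a else 0)" for n l a
    have h': "unit_fun (h' n l)" for n l
      using unit_fun_mult[OF unit_fun_indicator[OF B(2)] h] unit_fun_const[of 0]
      by (cases "l \<in> I") (auto simp: h'_def[abs_def])
    have eq: "indicator A x * ?T n x =
        (\<Prod>l\<in>I. h' n l (x l)) * (tensor_F E (U n) x - tensor_F E W x)"
      if "x \<in> space (Pw I)" for n x
    proof -
      have "indicator A x = (\<Prod>l\<in>I. indicator (B l) (x l) :: real)"
        using that I B(1) by (auto simp: space_PiM PiE_iff indicator_def prod_zero_iff)
      then show ?thesis by (simp add: h'_def prod.distrib mult_ac cong: prod.cong)
    qed
    have bnd: "norm (\<integral>x. indicator A x * ?T n x \<partial>Pw I)
        \<le> card E * cut_norm M (\<lambda>x y. U n x y - W x y)" for n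
      using counting[where U = "U n" and h = "h' n", OF I U W h' E]
      by (simp add: eq cong: Bochner_Integration.integral_cong)
    have "(\<lambda>n. card E * cut_norm M (\<lambda>x y. U n x y - W x y)) \<longlonglongrightarrow> 0"
      by (rule tendsto_mult_right_zero[OF cut])
    then show ?thesis
      by (rule Lim_null_comparison[rotated]) (rule always_eventually, rule allI, rule bnd)
  qed
qed (rule g)

section \<open>Correcting the marginals\<close>

text \<open>Real-valued version of the section integrals in the tiling condition;
  \<open>ennreal_marg\<close> links the two for bounded nonnegative \<open>f\<close>.\<close>

definition marg :: "nat set \<Rightarrow> ((nat \<Rightarrow> 'a) \<Rightarrow> real) \<Rightarrow> nat \<Rightarrow> 'a \<Rightarrow> real" where
  "marg I f l a = (\<integral>y. f (y(l := a)) \<partial>Pw (I - {l}))"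

lemma section_measurable:
  assumes I: "l \<in> I" and f: "f \<in> borel_measurable (Pw I)"
  shows "(\<lambda>(y, a). f (y(l := a))) \<in> borel_measurable (Pw (I - {l}) \<Otimes>\<^sub>M M)"
    and "(\<lambda>y. f (y(l := a))) \<in> borel_measurable (Pw (I - {l}))"
proof -
  have ins: "insert l (I - {l}) = I" using I by auto
  show *: "(\<lambda>(y, a). f (y(l := a))) \<in> borel_measurable (Pw (I - {l}) \<Otimes>\<^sub>M M)"
    using measurable_compose[OF measurable_add_dim[of l "I - {l}" "\<lambda>_. M", unfolded ins] f]
    by (simp add: case_prod_unfold)
  have "(\<lambda>y. (y, a)) \<in> Pw (I - {l}) \<rightarrow>\<^sub>M Pw (I - {l}) \<Otimes>\<^sub>M M" by simp
  from measurable_compose[OF this *] show "(\<lambda>y. f (y(l := a))) \<in> borel_measurable (Pw (I - {l}))"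
    by simp
qed

context
  fixes I :: "nat set" and f :: "(nat \<Rightarrow> 'a) \<Rightarrow> real" and C :: real and l :: nat
  assumes I: "finite I" "l \<in> I" and f: "f \<in> borel_measurable (Pw I)" "\<And>x. \<bar>f x\<bar> \<le> C"
begin

lemma section_integrable: "integrable (Pw (I - {l})) (\<lambda>y. f (y(l := a)))"
  by (rule integrable_Pw_bdd[OF section_measurable(2)[OF I(2) f(1)] f(2)])

lemma marg_measurable: "marg I f l \<in> borel_measurable M"
proof -
  interpret pair_sigma_finite M "Pw (I - {l})"
    by (rule pair_sigma_finite.intro) (auto intro: sigma_finite_measure prob_space_imp_sigma_finite
        prob_space_axioms prob_space_Pw)
  have "(\<lambda>(a, y). f (y(l := a))) \<in> borel_measurable (M \<Otimes>\<^sub>M Pw (I - {l}))"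
    using measurable_pair_swap[OF section_measurable(1)[OF I(2) f(1)]] by simp
  then show ?thesis
    unfolding marg_def[abs_def] by (rule M2.borel_measurable_lebesgue_integral)
qed

lemma integral_eq_integral_section:
  "(\<integral>x. f x \<partial>Pw I) = (\<integral>a. marg I f l a \<partial>M)"
proof -
  interpret J: prob_space "Pw (I - {l})" by (rule prob_space_Pw)
  interpret JM: pair_prob_space "Pw (I - {l})" M by unfold_locales
  have ins: "insert l (I - {l}) = I" using I by auto
  have "(\<integral>x. f x \<partial>Pw I) = (\<integral>y. \<integral>a. f (y(l := a)) \<partial>M \<partial>Pw (I - {l}))"
    using P.product_integral_insert[of "I - {l}" l f, unfolded ins] integrable_Pw_bdd[OF f] I by simp
  also have "\<dots> = (\<integral>a. \<integral>y. f (y(l := a)) \<partial>Pw (I - {l}) \<partial>M)"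
  proof (rule JM.Fubini_integral[symmetric])
    show "integrable (Pw (I - {l}) \<Otimes>\<^sub>M M) (\<lambda>(y, a). f (y(l := a)))"
      using f(2) by (intro JM.P.integrable_const_bound[where B = C] section_measurable I f(1)) (auto intro!: AE_I2)
  qed
  finally show ?thesis by (simp add: marg_def)
qed

lemma marg_abs_le: "\<bar>marg I f l a\<bar> \<le> C"
proof -
  interpret J: prob_space "Pw (I - {l})" by (rule prob_space_Pw)
  have "norm (marg I f l a) \<le> (\<integral>y. C \<partial>Pw (I - {l}))"
    unfolding marg_def using section_integrable f(2)
    by (intro integral_norm_bound[THEN order_trans] integral_mono) auto
  then show ?thesis by (simp add: prob_space.prob_space[OF prob_space_Pw])
qed

lemma ennreal_marg:
  assumes "\<And>x. 0 \<le> f x"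
  shows "ennreal (marg I f l a) = (\<integral>\<^sup>+y. ennreal (f (y(l := a))) \<partial>Pw (I - {l}))"
  unfolding marg_def using assms by (intro nn_integral_eq_integral[symmetric] section_integrable) auto

end

text \<open>The factor \<open>u (x l)\<close> is constant on each section with fixed
  \<open>l\<close>-th coordinate, so it leaves the inner integral after Fubini.\<close>

lemma integral_mult_coord:
  assumes I: "finite I" "l \<in> I" and f: "f \<in> borel_measurable (Pw I)" "\<And>x. \<bar>f x\<bar> \<le> C"
    and u: "unit_fun u"
  shows "(\<integral>x. f x * u (x l) \<partial>Pw I) = (\<integral>a. marg I f l a * u a \<partial>M)"
proof -
  have "(\<lambda>x. f x * u (x l)) \<in> borel_measurable (Pw I)"
    using measurable_compose[OF measurable_component_singleton[OF I(2)], of u "\<lambda>_. M" borel]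
      unit_fun_measurable[OF u] f(1) by simp
  moreover have "\<bar>f x * u (x l)\<bar> \<le> C" for x
    using f(2)[of x] unit_fun_abs[OF u, of "x l"] mult_mono[of "\<bar>f x\<bar>" C "\<bar>u (x l)\<bar>" 1]
    by (simp add: abs_mult)
  ultimately have "(\<integral>x. f x * u (x l) \<partial>Pw I) = (\<integral>a. marg I (\<lambda>x. f x * u (x l)) l a \<partial>M)"
    by (rule integral_eq_integral_section[OF I])
  then show ?thesis by (simp add: marg_def)
qed

section \<open>Tilings obtained from bounded weights\<close>

lemma coord_measurable:
  assumes "l \<in> I" "w \<in> borel_measurable M"
  shows "(\<lambda>x. w (x l)) \<in> borel_measurable (Pw I)"
  using assms by measurable

text \<open>Multiplying the weighted tensor power of \<open>U\<close> by \<open>w\<close> at every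
  coordinate enforces the marginal condition. The lost mass is at most the integral of the excess of
  the total marginal over 1. As the total marginal for \<open>W\<close> is at most 1, the excess is
  dominated by the difference of the two marginals on the set indicated by \<open>\<phi>\<close>, a
  quantity that the counting lemma controls.\<close>

lemma til_ge_of_bounded_weight:
  assumes E: "fin_graph k E" and U: "graphon M U" and W: "graphon M W"
    and g: "g \<in> borel_measurable (Pw {0..<k})" "\<And>x. 0 \<le> g x" "\<And>x. g x \<le> K"
    and W1: "\<And>a. (\<Sum>l<k. marg {0..<k} (\<lambda>x. g x * tensor_F E W x) l a) \<le> 1"
  defines "\<phi> \<equiv> indicator {a. (\<Sum>l<k. marg {0..<k} (\<lambda>x. g x * tensor_F E U x) l a) > 1}"
  shows "unit_fun \<phi>"
    and "ennreal ((\<integral>x. g x * tensor_F E U x \<partial>Pw {0..<k})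
      - (\<Sum>l<k. \<integral>x. g x * (\<phi> (x l) * (tensor_F E U x - tensor_F E W x)) \<partial>Pw {0..<k}))
      \<le> til M k E U"
proof -
  let ?I = "{0..<k}"
  define F where "F X x = g x * tensor_F E X x" for X x
  define tot where "tot X a = (\<Sum>l<k. marg ?I (F X) l a)" for X a
  have sub: "E \<subseteq> ?I \<times> ?I" using E by (auto simp: fin_graph_def)
  have Fm: "F X \<in> borel_measurable (Pw ?I)" if "graphon M X" for X
    unfolding F_def[abs_def] by (intro borel_measurable_times g(1) tensor_F_measurable sub that)
  have F0: "0 \<le> F X x" if "graphon M X" for X x
    unfolding F_def using g(2) tensor_F_bounds[OF that] by simp
  have F1: "\<bar>F X x\<bar> \<le> K" if "graphon M X" for X x
  proof -
    have "F X x \<le> g x * 1"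
      unfolding F_def using g(2) tensor_F_bounds[OF that] by (intro mult_left_mono) auto
    then show ?thesis using F0[OF that, of x] g(3)[of x] by simp
  qed
  have mm: "marg ?I (F X) l \<in> borel_measurable M" if "graphon M X" "l < k" for X l
    using marg_measurable[of ?I l "F X" K] Fm[OF that(1)] F1[OF that(1)] that(2) by simp
  have mb: "\<bar>marg ?I (F X) l a\<bar> \<le> K" if "graphon M X" "l < k" for X l a
    using marg_abs_le[of ?I l "F X" K] Fm[OF that(1)] F1[OF that(1)] that(2) by simp
  have m0: "0 \<le> marg ?I (F X) l a" if "graphon M X" for X l a
    unfolding marg_def using F0[OF that] by (intro integral_nonneg_AE) simp
  have tm: "tot X \<in> borel_measurable M" if "graphon M X" for X
    unfolding tot_def[abs_def] using mm[OF that] by (intro borel_measurable_sum) auto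
  have t0: "0 \<le> tot X a" if "graphon M X" for X a
    unfolding tot_def using m0[OF that] by (intro sum_nonneg)
  have \<phi>_eq: "\<phi> = indicator {a. tot U a > 1}"
    unfolding \<phi>_def tot_def F_def ..
  have "{a. 1 < tot U a} \<in> sets M"
    using borel_measurable_less[of "\<lambda>_. 1" M "tot U"] tm[OF U] by simp
  then show \<phi>: "unit_fun \<phi>" unfolding \<phi>_eq by (rule unit_fun_indicator)
  \<comment> \<open>The factor is 1 wherever the total marginal respects the bound, and otherwise
    rescales that marginal to 1.\<close>
  define w where "w a = 1 / max 1 (tot U a)" for a
  have wm: "w \<in> borel_measurable M"
    unfolding w_def[abs_def] using tm[OF U] by simp
  have w01: "0 \<le> w a" "w a \<le> 1" for a
    unfolding w_def by (auto simp: divide_simps)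
  have uw: "unit_fun w" "unit_fun (\<lambda>a. 1 - w a)"
    unfolding unit_fun_def using wm w01 by auto
  define t where "t x = F U x * (\<Prod>l<k. w (x l))" for x
  have Pm: "(\<lambda>x. \<Prod>l<k. w (x l)) \<in> borel_measurable (Pw ?I)"
    by (intro borel_measurable_prod coord_measurable wm) auto
  have P01: "0 \<le> (\<Prod>l<k. w (x l))" "(\<Prod>l<k. w (x l)) \<le> 1" for x
    using w01 by (auto intro!: prod_nonneg prod_le_1)
  have tM: "t \<in> borel_measurable (Pw ?I)"
    unfolding t_def[abs_def] by (intro borel_measurable_times Fm[OF U] Pm)
  have t_nonneg: "0 \<le> t x" for x unfolding t_def using F0[OF U] P01 by simp
  \<comment> \<open>For the section at coordinate \<open>l\<close> only the factor
    \<open>w (x l)\<close> is kept; the others are at most 1.\<close>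
  have t_le: "t x \<le> F U x * w (x l)" if "l < k" for x l
  proof -
    have "(\<Prod>l<k. w (x l)) = w (x l) * (\<Prod>i\<in>{..<k} - {l}. w (x i))"
      using that by (intro prod.remove) auto
    also have "\<dots> \<le> w (x l) * 1"
      using w01 by (intro mult_left_mono prod_le_1) auto
    finally show ?thesis unfolding t_def using F0[OF U] by (simp add: mult_left_mono)
  qed
  have tb: "\<bar>t x\<bar> \<le> K" for x
  proof -
    have "t x \<le> F U x * 1" unfolding t_def using F0[OF U] P01 by (intro mult_left_mono) auto
    then show ?thesis using t_nonneg[of x] F1[OF U, of x] by simp
  qed
  have til: "F_tiling M k E U t"
    unfolding F_tiling_def
  proof (intro conjI ballI impI)
    fix x assume "t x \<noteq> 0"
    then show "tensor_F E U x \<noteq> 0" by (auto simp: t_def F_def)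
  next
    fix a
    have "(\<Sum>l<k. \<integral>\<^sup>+ y. ennreal (t (y(l := a))) \<partial>Pw (?I - {l}))
        \<le> (\<Sum>l<k. ennreal (marg ?I (F U) l a * w a))"
    proof (rule sum_mono)
      fix l assume "l \<in> {..<k}"
      then have l: "l \<in> ?I" "l < k" by auto
      have le: "t (y(l := a)) \<le> F U (y(l := a)) * w a" for y
        using t_le[OF l(2), of "y(l := a)"] by simp
      have "(\<integral>\<^sup>+ y. ennreal (t (y(l := a))) \<partial>Pw (?I - {l}))
          \<le> (\<integral>\<^sup>+ y. ennreal (F U (y(l := a))) * ennreal (w a) \<partial>Pw (?I - {l}))"
        using le w01 F0[OF U] by (intro nn_integral_mono) (simp flip: ennreal_mult)
      also have "\<dots> = (\<integral>\<^sup>+ y. ennreal (F U (y(l := a))) \<partial>Pw (?I - {l})) * ennreal (w a)"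
        using section_measurable(2)[OF l(1) Fm[OF U], of a]
        by (intro nn_integral_multc) simp
      also have "\<dots> = ennreal (marg ?I (F U) l a) * ennreal (w a)"
        using ennreal_marg[of ?I l "F U" K a] l(1) Fm[OF U] F1[OF U] F0[OF U] by simp
      finally show "(\<integral>\<^sup>+ y. ennreal (t (y(l := a))) \<partial>Pw (?I - {l})) \<le> ennreal (marg ?I (F U) l a * w a)"
        using m0[OF U] w01 by (simp add: ennreal_mult)
    qed
    also have "\<dots> = ennreal (tot U a * w a)"
      unfolding tot_def sum_distrib_right using m0[OF U] w01 by (intro sum_ennreal) auto
    also have "\<dots> \<le> 1"
      using t0[OF U, of a] unfolding w_def by (auto simp: divide_simps max_def)
    finally show "(\<Sum>l<k. \<integral>\<^sup>+ y. ennreal (t (y(l := a))) \<partial>Pw (?I - {l})) \<le> 1" .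
  qed (use tM t_nonneg in auto)
  have Fi: "integrable (Pw ?I) (F X)" if "graphon M X" for X
    by (rule integrable_Pw_bdd[OF Fm[OF that] F1[OF that]])
  have Fui: "integrable (Pw ?I) (\<lambda>x. F X x * u (x l))"
    if X: "graphon M X" and u: "unit_fun u" and l: "l < k" for X u l
  proof (rule integrable_Pw_bdd)
    show "(\<lambda>x. F X x * u (x l)) \<in> borel_measurable (Pw ?I)"
      using l by (intro borel_measurable_times Fm[OF X] coord_measurable unit_fun_measurable[OF u]) auto
    show "\<bar>F X x * u (x l)\<bar> \<le> K * 1" for x
      unfolding abs_mult using F1[OF X, of x] unit_fun_abs[OF u, of "x l"]
      by (intro mult_mono) auto
  qed
  have coord: "(\<integral>x. F X x * u (x l) \<partial>Pw ?I) = (\<integral>a. marg ?I (F X) l a * u a \<partial>M)"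
    if X: "graphon M X" and u: "unit_fun u" and l: "l < k" for X u l
    by (rule integral_mult_coord[OF _ _ Fm[OF X] F1[OF X] u]) (use l in auto)
  have mui: "integrable M (\<lambda>a. marg ?I (F X) l a * u a)"
    if X: "graphon M X" and u: "unit_fun u" and l: "l < k" for X u l
  proof (rule integrable_const_bound[where B = "K * 1"])
    show "AE a in M. norm (marg ?I (F X) l a * u a) \<le> K * 1"
      unfolding real_norm_def abs_mult using mb[OF X l] unit_fun_abs[OF u]
      by (intro AE_I2 mult_mono) (auto intro: order_trans[OF abs_ge_zero])
    show "(\<lambda>a. marg ?I (F X) l a * u a) \<in> borel_measurable M"
      by (intro borel_measurable_times mm[OF X l] unit_fun_measurable[OF u])
  qed
  have tot_int: "(\<Sum>l<k. \<integral>x. F X x * u (x l) \<partial>Pw ?I) = (\<integral>a. tot X a * u a \<partial>M)"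
    "integrable M (\<lambda>a. tot X a * u a)"
    if X: "graphon M X" and u: "unit_fun u" for X u
    unfolding tot_def sum_distrib_right
    using coord[OF X u] mui[OF X u]
    by (auto simp: Bochner_Integration.integral_sum intro!: Bochner_Integration.integrable_sum)
  have loss: "(\<Sum>l<k. \<integral>x. F U x * (1 - w (x l)) \<partial>Pw ?I)
      \<le> (\<Sum>l<k. \<integral>x. g x * (\<phi> (x l) * (tensor_F E U x - tensor_F E W x)) \<partial>Pw ?I)"
  proof -
    \<comment> \<open>Where \<open>tot U a\<close> exceeds 1 the left side is
      \<open>tot U a - 1\<close> and \<open>tot W a\<close> is at most 1; elsewhere both sides
      vanish.\<close>
    have pt: "tot U a * (1 - w a) \<le> tot U a * \<phi> a - tot W a * \<phi> a" for a
    proof (cases "tot U a > 1")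
      case True
      then have "tot U a * (1 - w a) = tot U a - 1" by (simp add: w_def field_simps)
      moreover have "tot W a \<le> 1" using W1[of a] by (simp add: tot_def F_def[abs_def])
      ultimately show ?thesis using True by (simp add: \<phi>_eq)
    next
      case False
      then have "w a = 1" by (simp add: w_def max_def)
      then show ?thesis using False by (simp add: \<phi>_eq)
    qed
    have "(\<Sum>l<k. \<integral>x. F U x * (1 - w (x l)) \<partial>Pw ?I) = (\<integral>a. tot U a * (1 - w a) \<partial>M)"
      by (rule tot_int(1)[OF U uw(2)])
    also have "\<dots> \<le> (\<integral>a. tot U a * \<phi> a - tot W a * \<phi> a \<partial>M)"
      using tot_int(2)[OF U uw(2)] tot_int(2)[OF U \<phi>] tot_int(2)[OF W \<phi>] pt
      by (intro integral_mono Bochner_Integration.integrable_diff)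
    also have "\<dots> = (\<Sum>l<k. \<integral>x. F U x * \<phi> (x l) \<partial>Pw ?I) - (\<Sum>l<k. \<integral>x. F W x * \<phi> (x l) \<partial>Pw ?I)"
      unfolding tot_int(1)[OF U \<phi>] tot_int(1)[OF W \<phi>]
      by (rule Bochner_Integration.integral_diff[OF tot_int(2)[OF U \<phi>] tot_int(2)[OF W \<phi>]])
    also have "\<dots> = (\<Sum>l<k. (\<integral>x. F U x * \<phi> (x l) \<partial>Pw ?I) - (\<integral>x. F W x * \<phi> (x l) \<partial>Pw ?I))"
      by (rule sum_subtractf[symmetric])
    also have "\<dots> = (\<Sum>l<k. \<integral>x. g x * (\<phi> (x l) * (tensor_F E U x - tensor_F E W x)) \<partial>Pw ?I)"
    proof (rule sum.cong[OF refl])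
      fix l assume "l \<in> {..<k}"
      then have l: "l < k" by simp
      show "(\<integral>x. F U x * \<phi> (x l) \<partial>Pw ?I) - (\<integral>x. F W x * \<phi> (x l) \<partial>Pw ?I)
          = (\<integral>x. g x * (\<phi> (x l) * (tensor_F E U x - tensor_F E W x)) \<partial>Pw ?I)"
        unfolding Bochner_Integration.integral_diff[OF Fui[OF U \<phi> l] Fui[OF W \<phi> l], symmetric]
        by (simp add: F_def algebra_simps)
    qed
    finally show ?thesis .
  qed
  have Si: "integrable (Pw ?I) (\<lambda>x. \<Sum>l<k. F U x * (1 - w (x l)))"
    using Fui[OF U uw(2)] by (intro Bochner_Integration.integrable_sum) simp
  have "(\<integral>x. F U x \<partial>Pw ?I) - (\<Sum>l<k. \<integral>x. F U x * (1 - w (x l)) \<partial>Pw ?I)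
      = (\<integral>x. F U x - (\<Sum>l<k. F U x * (1 - w (x l))) \<partial>Pw ?I)"
    unfolding Bochner_Integration.integral_diff[OF Fi[OF U] Si]
    using Fui[OF U uw(2)] by (subst Bochner_Integration.integral_sum) auto
  also have "\<dots> \<le> (\<integral>x. t x \<partial>Pw ?I)"
  proof (rule integral_mono)
    show "integrable (Pw ?I) (\<lambda>x. F U x - (\<Sum>l<k. F U x * (1 - w (x l))))"
      by (rule Bochner_Integration.integrable_diff[OF Fi[OF U] Si])
    show "integrable (Pw ?I) t" by (rule integrable_Pw_bdd[OF tM tb])
    show "F U x - (\<Sum>l<k. F U x * (1 - w (x l))) \<le> t x" for x
    proof -
      \<comment> \<open>The Weierstrass inequality turns the loss of the product into the sum of the
        losses at single coordinates.\<close>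
      have "1 - (\<Sum>l<k. 1 - w (x l)) \<le> (\<Prod>l<k. 1 - (1 - w (x l)))"
        by (rule Weierstrass_prod_ineq) (use w01 in auto)
      from mult_left_mono[OF this F0[OF U, of x]] show ?thesis
        by (simp add: t_def sum_distrib_left right_diff_distrib)
    qed
  qed
  finally have size: "(\<integral>x. F U x \<partial>Pw ?I)
      - (\<Sum>l<k. \<integral>x. g x * (\<phi> (x l) * (tensor_F E U x - tensor_F E W x)) \<partial>Pw ?I) \<le> (\<integral>x. t x \<partial>Pw ?I)"
    using loss by linarith
  have "ennreal (\<integral>x. t x \<partial>Pw ?I) = tiling_size M k t"
    unfolding tiling_size_def using t_nonneg
    by (intro nn_integral_eq_integral[symmetric] integrable_Pw_bdd[OF tM tb]) auto
  also have "\<dots> \<le> til M k E U"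
    unfolding til_def using til by (intro SUP_upper) simp
  finally show "ennreal ((\<integral>x. g x * tensor_F E U x \<partial>Pw ?I)
      - (\<Sum>l<k. \<integral>x. g x * (\<phi> (x l) * (tensor_F E U x - tensor_F E W x)) \<partial>Pw ?I))
      \<le> til M k E U"
    using ennreal_leI[OF size] by (simp add: F_def)
qed

text \<open>In the size bound of \<open>til_ge_of_bounded_weight\<close> the main term converges by
  \<open>tensor_F_tendsto\<close> with all weights 1, and every error term tends to 0 by the same
  lemma. The sets behind \<open>\<phi> n\<close> vary with n without any limit, which is why
  uniformity in the weights matters.\<close>

lemma liminf_til_ge_bounded_weight:
  assumes E: "fin_graph k E" and U: "\<And>n. graphon M (U n)" and W: "graphon M W"
    and cut: "(\<lambda>n. cut_norm M (\<lambda>x y. U n x y - W x y)) \<longlonglongrightarrow> 0"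
    and g: "g \<in> borel_measurable (Pw {0..<k})" "\<And>x. 0 \<le> g x" "\<And>x. g x \<le> K"
    and W1: "\<And>a. (\<Sum>l<k. marg {0..<k} (\<lambda>x. g x * tensor_F E W x) l a) \<le> 1"
  shows "ennreal (\<integral>x. g x * tensor_F E W x \<partial>Pw {0..<k}) \<le> liminf (\<lambda>n. til M k E (U n))"
proof -
  let ?I = "{0..<k}"
  define \<phi> where "\<phi> n = (indicator
    {a. (\<Sum>l<k. marg ?I (\<lambda>x. g x * tensor_F E (U n) x) l a) > 1} :: 'a \<Rightarrow> real)" for n
  note til = til_ge_of_bounded_weight[OF E U W g W1]
  have \<phi>: "unit_fun (\<phi> n)" for n
    unfolding \<phi>_def by (rule til(1))
  have E': "E \<subseteq> {(i, j). i < j \<and> i \<in> ?I \<and> j \<in> ?I}" using E by (auto simp: fin_graph_def)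
  then have sub: "E \<subseteq> ?I \<times> ?I" by auto
  have gi: "integrable (Pw ?I) g"
    using g by (intro integrable_Pw_bdd[where C = K]) auto
  have gX: "integrable (Pw ?I) (\<lambda>x. g x * tensor_F E X x)" if X: "graphon M X" for X
  proof (rule integrable_Pw_bdd)
    show "(\<lambda>x. g x * tensor_F E X x) \<in> borel_measurable (Pw ?I)"
      by (intro borel_measurable_times g(1) tensor_F_measurable[OF sub X])
    show "\<bar>g x * tensor_F E X x\<bar> \<le> K * 1" for x
      unfolding abs_mult using g(2,3)[of x] tensor_F_bounds[OF X, of E x]
      by (intro mult_mono) auto
  qed
  have "(\<lambda>n. \<integral>x. g x * tensor_F E (U n) x \<partial>Pw ?I) \<longlonglongrightarrow> (\<integral>x. g x * tensor_F E W x \<partial>Pw ?I)"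
  proof -
    have "(\<lambda>n. \<integral>x. g x * ((\<Prod>l\<in>?I. 1) * (tensor_F E (U n) x - tensor_F E W x)) \<partial>Pw ?I)
        \<longlonglongrightarrow> 0"
      by (rule tensor_F_tendsto[OF _ U W _ E' cut gi]) (auto intro: unit_fun_const)
    then have "(\<lambda>n. (\<integral>x. g x * tensor_F E (U n) x \<partial>Pw ?I) - (\<integral>x. g x * tensor_F E W x \<partial>Pw ?I))
        \<longlonglongrightarrow> 0"
      by (simp add: right_diff_distrib Bochner_Integration.integral_diff[OF gX[OF U] gX[OF W]])
    then show ?thesis by (rule LIM_zero_cancel)
  qed
  moreover have "(\<lambda>n. \<integral>x. g x * (\<phi> n (x l) * (tensor_F E (U n) x - tensor_F E W x)) \<partial>Pw ?I)
      \<longlonglongrightarrow> 0" if l: "l < k" for l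
  proof -
    \<comment> \<open>The weight \<open>\<phi> n\<close> sits at the single coordinate
      \<open>l\<close>, so the product of weights reduces to \<open>\<phi> n (x l)\<close>.\<close>
    define h where "h n i = (if i = l then \<phi> n else (\<lambda>_. 1))" for n i
    have h: "unit_fun (h n i)" for n i
      unfolding h_def using \<phi> unit_fun_const[of 1] by auto
    have "(\<Prod>i\<in>?I. h n i (x i)) = \<phi> n (x l)" for n x
    proof -
      have "(\<Prod>i\<in>?I. h n i (x i)) = (\<Prod>i\<in>?I. if i = l then \<phi> n (x i) else 1)"
        by (intro prod.cong) (auto simp: h_def)
      then show ?thesis using l by simp
    qed
    then show ?thesis using tensor_F_tendsto[where h = h, OF _ U W h E' cut gi] by simp
  qed
  ultimately have "(\<lambda>n. (\<integral>x. g x * tensor_F E (U n) x \<partial>Pw ?I)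
      - (\<Sum>l<k. \<integral>x. g x * (\<phi> n (x l) * (tensor_F E (U n) x - tensor_F E W x)) \<partial>Pw ?I))
      \<longlonglongrightarrow> (\<integral>x. g x * tensor_F E W x \<partial>Pw ?I) - (\<Sum>l<k. 0)"
    by (intro tendsto_diff tendsto_sum) auto
  then have "(\<lambda>n. ennreal ((\<integral>x. g x * tensor_F E (U n) x \<partial>Pw ?I)
      - (\<Sum>l<k. \<integral>x. g x * (\<phi> n (x l) * (tensor_F E (U n) x - tensor_F E W x)) \<partial>Pw ?I)))
      \<longlonglongrightarrow> ennreal (\<integral>x. g x * tensor_F E W x \<partial>Pw ?I)"
    by (intro tendsto_ennrealI) simp
  from lim_imp_Liminf[OF _ this]
  have "ennreal (\<integral>x. g x * tensor_F E W x \<partial>Pw ?I) = liminf (\<lambda>n. ennreal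
      ((\<integral>x. g x * tensor_F E (U n) x \<partial>Pw ?I)
      - (\<Sum>l<k. \<integral>x. g x * (\<phi> n (x l) * (tensor_F E (U n) x - tensor_F E W x)) \<partial>Pw ?I)))"
    by simp
  also have "\<dots> \<le> liminf (\<lambda>n. til M k E (U n))"
    by (rule Liminf_mono, rule always_eventually, rule allI, unfold \<phi>_def, rule til(2))
  finally show ?thesis .
qed

text \<open>The quotient of a tiling by the tensor power of \<open>W\<close> is cut off at height K.
  The product of the truncated quotient and the tensor power lies below the tiling and increases to
  it, so monotone convergence reduces the claim to bounded weights.\<close>

lemma til_le_liminf_of_cut_norm:
  assumes E: "fin_graph k E" and U: "\<And>n. graphon M (U n)" and W: "graphon M W"
    and cut: "(\<lambda>n. cut_norm M (\<lambda>x y. U n x y - W x y)) \<longlonglongrightarrow> 0"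
  shows "til M k E W \<le> liminf (\<lambda>n. til M k E (U n))"
  unfolding til_def[of M k E W]
proof (rule SUP_least)
  let ?I = "{0..<k}"
  fix t assume "t \<in> {t. F_tiling M k E W t}"
  then have tm: "t \<in> borel_measurable (Pw ?I)"
    and t0: "\<And>x. x \<in> space (Pw ?I) \<Longrightarrow> 0 \<le> t x"
    and tW: "\<And>x. x \<in> space (Pw ?I) \<Longrightarrow> t x \<noteq> 0 \<Longrightarrow> tensor_F E W x \<noteq> 0"
    and t1: "\<And>a. (\<Sum>l<k. \<integral>\<^sup>+ y. ennreal (t (y(l := a))) \<partial>Pw (?I - {l})) \<le> 1"
    by (simp_all add: F_tiling_def)
  have sub: "E \<subseteq> ?I \<times> ?I" using E by (auto simp: fin_graph_def)
  \<comment> \<open>Division by 0 yields 0, which agrees with \<open>t\<close> vanishing where the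
    tensor power does. The outer \<open>max 0\<close> gives nonnegativity also outside the product
    space, where nothing is known of \<open>t\<close>.\<close>
  define g where "g K x = max 0 (min (t x / tensor_F E W x) (real K))" for K x
  note Wb = tensor_F_bounds[OF W, of E]
  note Wm = tensor_F_measurable[OF sub W]
  have gm: "g K \<in> borel_measurable (Pw ?I)" for K
    unfolding g_def[abs_def] using tm Wm by measurable
  have g0: "0 \<le> g K x" "g K x \<le> real K" for K x unfolding g_def by auto
  have gW: "g K x * tensor_F E W x = min (t x) (real K * tensor_F E W x)"
    if "x \<in> space (Pw ?I)" for K x
  proof (cases "tensor_F E W x = 0")
    case True
    then have "t x = 0" using tW[OF that] by blast
    then show ?thesis using True by simp
  next
    case False
    then have w: "tensor_F E W x > 0" using Wb[of x] by simp
    then show ?thesis using t0[OF that] by (simp add: g_def max_def min_mult_distrib_right)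
  qed
  have Fm: "(\<lambda>x. g K x * tensor_F E W x) \<in> borel_measurable (Pw ?I)" for K
    by (intro borel_measurable_times gm Wm)
  have F0: "0 \<le> g K x * tensor_F E W x" for K x using g0 Wb by simp
  have Fb: "\<bar>g K x * tensor_F E W x\<bar> \<le> real K * 1" for K x
    unfolding abs_mult using g0[of K x] Wb[of x] by (intro mult_mono) auto
  have le: "ennreal (\<integral>x. g K x * tensor_F E W x \<partial>Pw ?I) \<le> liminf (\<lambda>n. til M k E (U n))" for K
  proof (rule liminf_til_ge_bounded_weight[OF E U W cut gm g0])
    fix a
    have "ennreal (\<Sum>l<k. marg ?I (\<lambda>x. g K x * tensor_F E W x) l a)
        = (\<Sum>l<k. ennreal (marg ?I (\<lambda>x. g K x * tensor_F E W x) l a))"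
      unfolding marg_def using F0 by (intro sum_ennreal[symmetric] integral_nonneg_AE) simp
    also have "\<dots> \<le> (\<Sum>l<k. \<integral>\<^sup>+ y. ennreal (t (y(l := a))) \<partial>Pw (?I - {l}))"
    proof (rule sum_mono)
      fix l assume "l \<in> {..<k}"
      then have l: "l \<in> ?I" by simp
      have "ennreal (marg ?I (\<lambda>x. g K x * tensor_F E W x) l a)
          = (\<integral>\<^sup>+ y. ennreal (g K (y(l := a)) * tensor_F E W (y(l := a))) \<partial>Pw (?I - {l}))"
        by (rule ennreal_marg[OF _ l Fm Fb F0]) simp
      also have "\<dots> \<le> (\<integral>\<^sup>+ y. ennreal (t (y(l := a))) \<partial>Pw (?I - {l}))"
      proof (intro nn_integral_mono ennreal_leI)
        fix y assume "y \<in> space (Pw (?I - {l}))"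
        then have "y(l := a) \<in> space (Pw ?I)"
          using l by (auto simp: space_PiM PiE_iff extensional_def)
        from gW[OF this, of K] show "g K (y(l := a)) * tensor_F E W (y(l := a)) \<le> t (y(l := a))"
          by simp
      qed
      finally show "ennreal (marg ?I (\<lambda>x. g K x * tensor_F E W x) l a)
          \<le> (\<integral>\<^sup>+ y. ennreal (t (y(l := a))) \<partial>Pw (?I - {l}))" .
    qed
    also have "\<dots> \<le> 1" by (rule t1)
    finally show "(\<Sum>l<k. marg ?I (\<lambda>x. g K x * tensor_F E W x) l a) \<le> 1" by simp
  qed
  have "tiling_size M k t = (\<integral>\<^sup>+ x. (SUP K. ennreal (g K x * tensor_F E W x)) \<partial>Pw ?I)"
    unfolding tiling_size_def
  proof (rule nn_integral_cong)
    fix x assume x: "x \<in> space (Pw ?I)"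
    \<comment> \<open>Once K exceeds the quotient, the truncation equals \<open>t x\<close>, so the
      pointwise supremum is attained.\<close>
    obtain K :: nat where K: "t x \<le> real K * tensor_F E W x"
    proof (cases "tensor_F E W x = 0")
      case True
      then have "t x = 0" using tW[OF x] by blast
      then have "t x \<le> real 0 * tensor_F E W x" by simp
      then show ?thesis by (rule that)
    next
      case False
      then have w: "tensor_F E W x > 0" using Wb[of x] by simp
      obtain K :: nat where "t x / tensor_F E W x \<le> real K" using real_arch_simple by blast
      then have "t x \<le> real K * tensor_F E W x" using w by (simp add: field_simps)
      then show ?thesis by (rule that)
    qed
    show "ennreal (t x) = (SUP K. ennreal (g K x * tensor_F E W x))"
    proof (rule antisym)
      show "ennreal (t x) \<le> (SUP K. ennreal (g K x * tensor_F E W x))"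
        by (rule SUP_upper2[of K]) (use K in \<open>simp_all add: gW[OF x]\<close>)
      show "(SUP K. ennreal (g K x * tensor_F E W x)) \<le> ennreal (t x)"
        by (rule SUP_least) (simp add: gW[OF x] ennreal_leI)
    qed
  qed
  also have "\<dots> = (SUP K. \<integral>\<^sup>+ x. ennreal (g K x * tensor_F E W x) \<partial>Pw ?I)"
  proof (rule nn_integral_monotone_convergence_SUP)
    show "incseq (\<lambda>K x. ennreal (g K x * tensor_F E W x))"
      unfolding incseq_def le_fun_def g_def using Wb
      by (intro allI impI ennreal_leI mult_right_mono) (auto intro: max.mono min.mono)
    show "(\<lambda>x. ennreal (g K x * tensor_F E W x)) \<in> borel_measurable (Pw ?I)" for K
      using Fm by simp
  qed
  also have "\<dots> \<le> liminf (\<lambda>n. til M k E (U n))"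
  proof (rule SUP_least)
    fix K
    have "(\<integral>\<^sup>+ x. ennreal (g K x * tensor_F E W x) \<partial>Pw ?I)
        = ennreal (\<integral>x. g K x * tensor_F E W x \<partial>Pw ?I)"
      by (rule nn_integral_eq_integral[OF integrable_Pw_bdd[OF Fm Fb]]) (use F0 in simp)
    then show "(\<integral>\<^sup>+ x. ennreal (g K x * tensor_F E W x) \<partial>Pw ?I) \<le> liminf (\<lambda>n. til M k E (U n))"
      using le by simp
  qed
  finally show "tiling_size M k t \<le> liminf (\<lambda>n. til M k E (U n))" .
qed

section \<open>Rearrangements\<close>

lemma graphon_compose:
  assumes \<psi>: "\<psi> \<in> M \<rightarrow>\<^sub>M M" and U: "graphon M U"
  shows "graphon M (\<lambda>x y. U (\<psi> x) (\<psi> y))"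
proof -
  note [measurable] = \<psi> bdd_kernel_case_prod[OF graphon_bdd_kernel[OF U]]
  have "(\<lambda>(x, y). U (\<psi> x) (\<psi> y)) \<in> borel_measurable (M \<Otimes>\<^sub>M M)" by measurable
  then show ?thesis using U by (simp add: graphon_def)
qed

context
  fixes \<phi> \<psi> :: "'a \<Rightarrow> 'a"
  assumes \<phi>: "\<phi> \<in> M \<rightarrow>\<^sub>M M" "distr M M \<phi> = M" and \<psi>: "\<psi> \<in> M \<rightarrow>\<^sub>M M"
    and inv: "\<And>x. \<psi> (\<phi> x) = x"
begin

lemma integral_mp: "f \<in> borel_measurable M \<Longrightarrow> (\<integral>x. f (\<phi> x) \<partial>M) = (\<integral>x. (f x :: real) \<partial>M)"
  using integral_distr[OF \<phi>(1), of f] by (simp add: \<phi>(2))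

text \<open>Substituting \<open>\<phi>\<close> in both variables undoes \<open>\<psi>\<close> on
  \<open>U\<close> and applies \<open>\<phi>\<close> to \<open>W\<close>, while a rectangle becomes
  the rectangle of preimages. The rearrangement can thus be moved from \<open>W\<close> to
  \<open>U\<close>.\<close>

lemma cut_norm_rearrange_le:
  assumes U: "graphon M U" and W: "graphon M W"
  shows "cut_norm M (\<lambda>x y. U (\<psi> x) (\<psi> y) - W x y) \<le> cut_norm M (\<lambda>x y. U x y - W (\<phi> x) (\<phi> y))"
proof (rule cut_norm_le)
  let ?V = "\<lambda>x y. U (\<psi> x) (\<psi> y) - W x y"
  have W': "graphon M (\<lambda>x y. W (\<phi> x) (\<phi> y))" by (rule graphon_compose[OF \<phi>(1) W])
  show V: "bdd_kernel ?V" by (rule graphon_diff_bdd_kernel[OF graphon_compose[OF \<psi> U] W])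
  fix A B assume A: "A \<in> sets M" and B: "B \<in> sets M"
  have pre: "\<phi> -` A \<in> sets M" "\<phi> -` B \<in> sets M"
    using measurable_sets[OF \<phi>(1) A] measurable_sets[OF \<phi>(1) B] by auto
  note [measurable] = bdd_kernel_case_prod[OF V] A B
  have "(\<integral>x. \<integral>y. ?V x y * (indicator A x * indicator B y) \<partial>M \<partial>M)
      = (\<integral>x. \<integral>y. ?V (\<phi> x) y * (indicator A (\<phi> x) * indicator B y) \<partial>M \<partial>M)"
    by (rule integral_mp[symmetric]) measurable
  also have "\<dots> = (\<integral>x. \<integral>y. ?V (\<phi> x) (\<phi> y) * (indicator A (\<phi> x) * indicator B (\<phi> y)) \<partial>M \<partial>M)"
    by (intro Bochner_Integration.integral_cong[OF refl] integral_mp[symmetric]) measurable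
  also have "\<dots> = (\<integral>x. \<integral>y. (U x y - W (\<phi> x) (\<phi> y)) *
      (indicator (\<phi> -` A) x * indicator (\<phi> -` B) y) \<partial>M \<partial>M)"
    by (simp add: inv indicator_def)
  finally show "\<bar>\<integral>x. \<integral>y. ?V x y * (indicator A x * indicator B y) \<partial>M \<partial>M\<bar>
      \<le> cut_norm M (\<lambda>x y. U x y - W (\<phi> x) (\<phi> y))"
    using rectangle_le_cut_norm[OF graphon_diff_bdd_kernel[OF U W'] pre] by simp
qed

lemma compose_measurable: "compose I \<phi> \<in> Pw I \<rightarrow>\<^sub>M Pw I"
  unfolding compose_def using \<phi>(1)
  by (intro measurable_restrict measurable_compose[OF measurable_component_singleton]) auto

text \<open>Applying a measure preserving map in each coordinate preserves the finite product
  measure; \<open>compose\<close> also keeps the result extensional on \<open>I\<close>.\<close>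

lemma nn_integral_compose:
  assumes "finite I" "f \<in> borel_measurable (Pw I)"
  shows "(\<integral>\<^sup>+x. f (compose I \<phi> x) \<partial>Pw I) = (\<integral>\<^sup>+x. f x \<partial>Pw I)"
proof -
  have "distr (Pw I) (Pw I) (compose I \<phi>) = Pw I"
    using distr_PiM_finite_prob_space'[OF assms(1), of "\<lambda>_. M" "\<lambda>_. M" \<phi>] \<phi> prob_space_axioms
    by simp
  then show ?thesis
    using nn_integral_distr[OF compose_measurable, of f I] assms(2) by simp
qed

text \<open>A tiling of the rearranged graphon is pulled back along \<open>\<phi>\<close>. Its
  support condition becomes that of \<open>U\<close> because \<open>\<psi>\<close> undoes
  \<open>\<phi>\<close>, its marginal at \<open>a\<close> is the old one at \<open>\<phi> a\<close>,
  and its size is unchanged.\<close>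

lemma til_rearrange_le:
  assumes E: "fin_graph k E"
  shows "til M k E (\<lambda>x y. U (\<psi> x) (\<psi> y)) \<le> til M k E U"
  unfolding til_def[of M k E "\<lambda>x y. U (\<psi> x) (\<psi> y)"]
proof (rule SUP_least)
  let ?I = "{0..<k}"
  fix t assume "t \<in> {t. F_tiling M k E (\<lambda>x y. U (\<psi> x) (\<psi> y)) t}"
  then have tm: "t \<in> borel_measurable (Pw ?I)"
    and t0: "\<And>x. x \<in> space (Pw ?I) \<Longrightarrow> 0 \<le> t x"
    and tU: "\<And>x. x \<in> space (Pw ?I) \<Longrightarrow> t x \<noteq> 0 \<Longrightarrow> tensor_F E (\<lambda>x y. U (\<psi> x) (\<psi> y)) x \<noteq> 0"
    and t1: "\<And>a. (\<Sum>l<k. \<integral>\<^sup>+ y. ennreal (t (y(l := a))) \<partial>Pw (?I - {l})) \<le> 1"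
    by (simp_all add: F_tiling_def)
  have sub: "E \<subseteq> ?I \<times> ?I" using E by (auto simp: fin_graph_def)
  define t' where "t' x = t (compose ?I \<phi> x)" for x
  have sp: "compose ?I \<phi> x \<in> space (Pw ?I)" for x
    by (auto simp: space_PiM compose_def)
  have t'm: "t' \<in> borel_measurable (Pw ?I)"
    unfolding t'_def[abs_def] by (rule measurable_compose[OF compose_measurable tm])
  have tens: "tensor_F E (\<lambda>x y. U (\<psi> x) (\<psi> y)) (compose ?I \<phi> x) = tensor_F E U x" for x
    unfolding tensor_F_def case_prod_unfold
    using sub by (intro prod.cong[OF refl]) (force simp: compose_def inv)
  have sec: "(\<integral>\<^sup>+ y. ennreal (t' (y(l := a))) \<partial>Pw (?I - {l}))
      = (\<integral>\<^sup>+ y. ennreal (t (y(l := \<phi> a))) \<partial>Pw (?I - {l}))" if l: "l < k" for l a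
  proof -
    have "compose ?I \<phi> (y(l := a)) = (compose (?I - {l}) \<phi> y)(l := \<phi> a)" for y
      using l by (auto simp: compose_def fun_eq_iff)
    then have "(\<integral>\<^sup>+ y. ennreal (t' (y(l := a))) \<partial>Pw (?I - {l}))
        = (\<integral>\<^sup>+ y. ennreal (t ((compose (?I - {l}) \<phi> y)(l := \<phi> a))) \<partial>Pw (?I - {l}))"
      by (simp add: t'_def)
    also have "\<dots> = (\<integral>\<^sup>+ y. ennreal (t (y(l := \<phi> a))) \<partial>Pw (?I - {l}))"
      using section_measurable(2)[OF _ tm, of l "\<phi> a"] l by (intro nn_integral_compose) auto
    finally show ?thesis .
  qed
  have "F_tiling M k E U t'"
    unfolding F_tiling_def
  proof (intro conjI ballI impI)
    show "0 \<le> t' x" for x unfolding t'_def by (rule t0[OF sp])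
    show "tensor_F E U x \<noteq> 0" if "t' x \<noteq> 0" for x
      using tU[OF sp, of x] that by (simp add: t'_def tens)
    show "(\<Sum>l<k. \<integral>\<^sup>+ y. ennreal (t' (y(l := a))) \<partial>Pw (?I - {l})) \<le> 1" for a
      using t1[of "\<phi> a"] by (simp add: sec)
  qed (rule t'm)
  then have "tiling_size M k t' \<le> til M k E U"
    unfolding til_def by (intro SUP_upper) simp
  moreover have "tiling_size M k t' = tiling_size M k t"
    unfolding tiling_size_def t'_def using tm by (intro nn_integral_compose) auto
  ultimately show "tiling_size M k t \<le> til M k E U" by simp
qed

end

section \<open>From cut norm to cut distance\<close>

lemma inv_mpD:
  assumes "inv_mp M \<phi>"
  shows "\<phi> \<in> M \<rightarrow>\<^sub>M M" "distr M M \<phi> = M" "the_inv_into UNIV \<phi> \<in> M \<rightarrow>\<^sub>M M"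
    "the_inv_into UNIV \<phi> (\<phi> x) = x"
  using assms by (auto simp: inv_mp_def bij_betw_def the_inv_into_f_f)

text \<open>Applying the inverse rearrangements to the sequence keeps the limit graphon fixed, so
  the result for cut norm convergence applies, and rearranging back does not decrease the tiling
  numbers.\<close>

theorem til_le_liminf_of_cut_dist:
  assumes E: "fin_graph k E" and U: "\<And>n. graphon M (U n)" and W: "graphon M W"
    and cut: "(\<lambda>n. cut_dist M (U n) W) \<longlonglongrightarrow> 0"
  shows "til M k E W \<le> liminf (\<lambda>n. til M k E (U n))"
proof -
  \<comment> \<open>The infimum in \<open>cut_dist\<close> may not be attained; the slack
    \<open>1 / real (Suc n)\<close> is positive and tends to 0.\<close>
  define good where "good n \<phi> \<longleftrightarrow> inv_mp M \<phi> \<and>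
    cut_norm M (\<lambda>x y. U n x y - W (\<phi> x) (\<phi> y)) < cut_dist M (U n) W + 1 / real (Suc n)" for n \<phi>
  have "\<exists>\<phi>. good n \<phi>" for n
    unfolding good_def by (rule cut_dist_lessD[of M "U n" W]) auto
  then obtain \<phi> where good: "good n (\<phi> n)" for n by metis
  then have \<phi>: "inv_mp M (\<phi> n)"
    "cut_norm M (\<lambda>x y. U n x y - W (\<phi> n x) (\<phi> n y)) < cut_dist M (U n) W + 1 / real (Suc n)" for n
    by (simp_all add: good_def)
  define \<psi> where "\<psi> n = the_inv_into UNIV (\<phi> n)" for n
  note mp = inv_mpD[OF \<phi>(1), folded \<psi>_def]
  define V where "V n x y = U n (\<psi> n x) (\<psi> n y)" for n x y
  have V: "graphon M (V n)" for n
    unfolding V_def by (rule graphon_compose[OF mp(3) U])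
  have nn: "0 \<le> cut_norm M (\<lambda>x y. V n x y - W x y)" for n
    by (rule cut_norm_nonneg[OF graphon_diff_bdd_kernel[OF V W]])
  have le: "cut_norm M (\<lambda>x y. V n x y - W x y) \<le> cut_dist M (U n) W + 1 / real (Suc n)" for n
    using cut_norm_rearrange_le[OF mp U W, of n n] \<phi>(2)[of n] unfolding V_def by linarith
  have "(\<lambda>n. cut_dist M (U n) W + 1 / real (Suc n)) \<longlonglongrightarrow> 0 + 0"
    by (intro tendsto_add cut LIMSEQ_Suc[OF lim_1_over_n])
  then have lim: "(\<lambda>n. cut_dist M (U n) W + 1 / real (Suc n)) \<longlonglongrightarrow> 0" by simp
  have "(\<lambda>n. cut_norm M (\<lambda>x y. V n x y - W x y)) \<longlonglongrightarrow> 0"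
    by (rule tendsto_sandwich[OF always_eventually always_eventually tendsto_const lim])
       (use nn le in auto)
  from til_le_liminf_of_cut_norm[OF E V W this]
  have "til M k E W \<le> liminf (\<lambda>n. til M k E (V n))" .
  also have "\<dots> \<le> liminf (\<lambda>n. til M k E (U n))"
    unfolding V_def by (intro Liminf_mono always_eventually allI til_rearrange_le[OF mp E])
  finally show ?thesis .
qed

end

theorem theorem3p7:
  fixes M :: "'a :: polish_space measure"
    and Ws :: "nat \<Rightarrow> 'a \<Rightarrow> 'a \<Rightarrow> real" and W :: "'a \<Rightarrow> 'a \<Rightarrow> real"
    and k :: nat and E :: "(nat \<times> nat) set"
  assumes "prob_space M" and "sets M = sets borel" and "atomless M"
    and "\<And>n. graphon M (Ws n)" and "graphon M W"
    and "(\<lambda>n. cut_dist M (Ws n) W) \<longlonglongrightarrow> 0"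
    and "fin_graph k E"
  shows "liminf (\<lambda>n. til M k E (Ws n)) \<ge> til M k E W"
proof -
  \<comment> \<open>Equal sigma-algebras have equal underlying spaces, and that of
    \<open>borel\<close> is the whole type.\<close>
  have "full_prob_space M"
    using assms(1) sets_eq_imp_space_eq[OF assms(2)]
    by (simp add: full_prob_space_def full_prob_space_axioms_def)
  then show ?thesis
    using assms(4-7) by (intro full_prob_space.til_le_liminf_of_cut_dist)
qed

end
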